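(* Let $D\subset\subset\mathbb{C}^n$ be a bounded domain. Let $N\subset D^2=D\times D$ be the set of all pairs $(a,b)$ such that there is no holomorphic automorphism $f$ of $D$ with $\mathrm{Fix}(f)=\{a,b\}$. Then $N$ contains a set of full (Lebesgue) measure in $D^2$, i.e. a subset of $D^2$ whose complement in $D^2$ has measure zero.
   Context: A domain is a connected nonempty open set. A holomorphic automorphism is a biholomorphic self-map, and $\mathrm{Fix}(f)=\{x\in D : f(x)=x\}$. *)

theory Defs
  imports "HOL-Analysis.Analysis"
begin

text \<open>
  Holomorphy in several variables is complex Frechet differentiability. The predicate
  \<^const>\<open>has_derivative\<close> only provides a real-linear derivative, so complex linearity with
  respect to the complex scalar multiplication is required separately.
\<close>

definition holomorphic_vec_on :: "(complex ^ 'n \<Rightarrow> complex ^ 'm) \<Rightarrow> (complex ^ 'n) set \<Rightarrow> bool"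
  where "holomorphic_vec_on f S \<longleftrightarrow>
    (\<forall>x\<in>S. \<exists>f'. (f has_derivative f') (at x within S) \<and> Vector_Spaces.linear (*s) (*s) f')"

definition domain_vec :: "(complex ^ 'n) set \<Rightarrow> bool"
  where "domain_vec D \<longleftrightarrow> open D \<and> connected D \<and> D \<noteq> {}"

text \<open>Maps are total functions; only their values on \<open>D\<close> matter.\<close>

definition holomorphic_automorphism :: "(complex ^ 'n) set \<Rightarrow> (complex ^ 'n \<Rightarrow> complex ^ 'n) \<Rightarrow> bool"
  where "holomorphic_automorphism D f \<longleftrightarrow>
    bij_betw f D D \<and> holomorphic_vec_on f D \<and> holomorphic_vec_on (inv_into D f) D"

definition Fix_on :: "'a set \<Rightarrow> ('a \<Rightarrow> 'a) \<Rightarrow> 'a set"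
  where "Fix_on D f = {x \<in> D. f x = x}"

end

theory Submission
  imports Defs "HOL-Complex_Analysis.Great_Picard"
begin

text \<open>
  Fix \<open>a\<close> and let \<open>K\<close> be the group of automorphisms of \<open>D\<close> fixing \<open>a\<close>. There is a holomorphic map
  \<open>L\<close> on \<open>D\<close> with \<open>L a = 0\<close>, \<open>L'(a) = id\<close> and \<open>L \<circ> g = g'(a) \<circ> L\<close> for all \<open>g \<in> K\<close>. Instead of averaging
  over Haar measure, \<open>L\<close> is obtained as the unique minimiser of a \<open>K\<close>-invariant strictly convex functional
  on a \<open>K\<close>-invariant convex set of maps that is compact by Montel's theorem. If \<open>f \<in> K\<close> also fixes \<open>b\<close>
  and \<open>L b \<noteq> 0\<close>, then \<open>L b\<close> is a fixed vector of \<open>f'(a)\<close>, so the points \<open>x\<close> near \<open>a\<close> with \<open>L x\<close> a small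
  multiple of \<open>L b\<close> are fixed by \<open>f\<close> and \<open>a\<close> is not isolated in \<open>Fix f\<close>. Hence the exceptional \<open>b\<close> lie in
  the zero set of \<open>L\<close>, which is null. By Cartan's theorem that \<open>K\<close> is compact, the exceptional pairs
  are covered by countably many closed sets with null sections, to which Fubini's theorem applies.
\<close>

section \<open>Holomorphic maps in several variables\<close>

text \<open>A supremum of strictly convex functionals need not be strictly convex, so uniqueness of
  the minimiser relies on the compactness of \<open>K\<close>. The map \<open>L\<close> is chosen
  separately for each \<open>a\<close>, with no measurability in \<open>a\<close>; null sections
  alone therefore do not suffice, and measurability of the covering sets has to come from
  closedness. The condition \<open>Fix f = {a, b}\<close> is not stable under limits, since a limit
  of automorphisms may have more fixed points. It is replaced by a bound
  \<open>\<delta> * norm (x - a) \<le> norm (f x - x)\<close> near \<open>a\<close>. Every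
  \<open>f\<close> with finite fixed point set satisfies such a bound, and the reason is again
  \<open>L\<close>: an eigenvector of \<open>f'(a)\<close> with eigenvalue 1 would create fixed
  points accumulating at \<open>a\<close>, so \<open>f'(a) - id\<close> is invertible.\<close>

abbreviation fderiv :: "('a::real_normed_vector \<Rightarrow> 'b::real_normed_vector) \<Rightarrow> 'a \<Rightarrow> 'a \<Rightarrow> 'b"
  where "fderiv f x \<equiv> frechet_derivative f (at x)"

abbreviation clinear :: "(complex ^ 'n \<Rightarrow> complex ^ 'm) \<Rightarrow> bool"
  where "clinear \<equiv> Vector_Spaces.linear (*s) (*s)"

lemma norm_vector_smult: "norm (c *s v) = norm c * norm v" for c :: complex and v :: "complex ^ 'n"
  by (simp add: norm_vec_def norm_mult L2_set_right_distrib)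

lemma of_real_smult: "of_real t *s v = t *\<^sub>R v" for v :: "complex ^ 'n"
  unfolding vec_eq_iff vector_smult_component vector_scaleR_component
  by (simp add: scaleR_conv_of_real)

lemma clinear_iff:
  fixes f :: "complex ^ 'n \<Rightarrow> complex ^ 'm"
  shows "clinear f \<longleftrightarrow> (\<forall>x y. f (x + y) = f x + f y) \<and> (\<forall>c x. f (c *s x) = c *s f x)"
  by (simp add: Vector_Spaces.linear_iff vec.vector_space_axioms)

lemma clinearI:
  fixes f :: "complex ^ 'n \<Rightarrow> complex ^ 'm"
  assumes "\<And>x y. f (x + y) = f x + f y" and "\<And>c x. f (c *s x) = c *s f x"
  shows "clinear f"
  using assms by (simp add: clinear_iff)

lemma clinear_scale: "clinear f \<Longrightarrow> f (c *s x) = c *s f x"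
  by (rule vec.linear_scale)

lemma bounded_linear_smult_left: "bounded_linear (\<lambda>c. c *s v)" for v :: "complex ^ 'n"
  by (rule bounded_linear_intro[where K = "norm v"])
     (auto simp: vec_eq_iff algebra_simps norm_vector_smult)

context
  fixes f :: "complex ^ 'n \<Rightarrow> complex ^ 'm" and D
  assumes f: "holomorphic_vec_on f D" and D: "open D"
begin

lemma holomorphic_vec_has_derivative:
  assumes "x \<in> D"
  shows "(f has_derivative fderiv f x) (at x)"
  using f D assms unfolding holomorphic_vec_on_def
  by (metis at_within_open frechet_derivative_works differentiable_def)

lemma holomorphic_vec_clinear:
  assumes "x \<in> D"
  shows "clinear (fderiv f x)"
  using f D assms unfolding holomorphic_vec_on_def
  by (metis at_within_open frechet_derivative_at)

lemma holomorphic_vec_continuous_on: "continuous_on D f"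
  by (meson D continuous_on_eq_continuous_at has_derivative_continuous holomorphic_vec_has_derivative)

text \<open>Bridge to one-variable theory: complex linearity turns the derivative along a complex
  line into multiplication by a complex number.\<close>

lemma holomorphic_vec_line:
  assumes "x + t *s v \<in> D"
  shows "((\<lambda>t. f (x + t *s v) $ i) has_field_derivative fderiv f (x + t *s v) v $ i) (at t)"
proof -
  have "((\<lambda>t. x + t *s v) has_derivative (\<lambda>s. 0 + s *s v)) (at t)"
    by (intro derivative_intros bounded_linear.has_derivative[OF bounded_linear_smult_left])
  then have "((\<lambda>t. f (x + t *s v)) has_derivative (\<lambda>s. fderiv f (x + t *s v) (s *s v))) (at t)"
    using has_derivative_compose[of "\<lambda>t. x + t *s v" _ t UNIV f, OF _ holomorphic_vec_has_derivative[OF assms]] by simp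
  then have "((\<lambda>t. f (x + t *s v) $ i) has_derivative (\<lambda>s. fderiv f (x + t *s v) (s *s v) $ i)) (at t)"
    by (rule bounded_linear.has_derivative[OF bounded_linear_vec_nth])
  moreover have "fderiv f (x + t *s v) (s *s v) $ i = fderiv f (x + t *s v) v $ i * s" for s
    by (simp add: clinear_scale[OF holomorphic_vec_clinear[OF assms]])
  ultimately show ?thesis
    by (simp add: has_field_derivative_def)
qed

lemma holomorphic_vec_on_line:
  assumes "\<And>t. t \<in> T \<Longrightarrow> x + t *s v \<in> D"
  shows "(\<lambda>t. f (x + t *s v) $ i) holomorphic_on T"
  using holomorphic_vec_line[OF assms, of _ i] unfolding holomorphic_on_def
  by (meson field_differentiable_at_within field_differentiable_def)

text \<open>One-variable Cauchy inequality on the complex line through \<open>x\<close> in direction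
  \<open>v\<close>, for each coordinate; summing the coordinates costs the factor
  \<open>CARD('m)\<close>.\<close>

lemma holomorphic_vec_Cauchy_estimate:
  fixes M r :: real
  assumes "r > 0" "cball x r \<subseteq> D" and le: "\<And>y. y \<in> cball x r \<Longrightarrow> norm (f y) \<le> M"
  shows "norm (fderiv f x v) \<le> CARD('m) * M / r * norm v"
proof (cases "v = 0")
  case True
  have "x \<in> D" using assms by auto
  then show ?thesis
    using True linear_0[OF has_derivative_linear[OF holomorphic_vec_has_derivative]] by simp
next
  case False
  \<comment> \<open>The largest parameter radius for which the line stays in
    \<open>cball x r\<close>.\<close>
  define s where "s = r / norm v"
  have s: "s > 0" using assms False by (simp add: s_def)
  have mem: "x + t *s v \<in> cball x r" if "norm t \<le> s" for t
    using that False by (simp add: dist_norm norm_vector_smult s_def field_simps)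
  have nn: "norm (fderiv f x v $ i) \<le> M / s" for i
  proof -
    let ?p = "\<lambda>t. f (x + t *s v) $ i"
    have hol: "?p holomorphic_on cball 0 s"
      using mem assms by (intro holomorphic_vec_on_line) auto
    have "norm ((deriv ^^ 1) ?p 0) \<le> fact 1 * M / s ^ 1"
    proof (rule Cauchy_inequality)
      show "?p holomorphic_on ball 0 s"
        using hol holomorphic_on_subset by (meson ball_subset_cball)
      show "continuous_on (cball 0 s) ?p"
        using hol holomorphic_on_imp_continuous_on by blast
      show "norm (?p t) \<le> M" if "norm (0 - t) = s" for t
        using le[OF mem[of t]] that Finite_Cartesian_Product.norm_nth_le[of "f (x + t *s v)" i] by simp
    qed (use s in auto)
    moreover have "x + 0 *s v \<in> D" using assms by auto
    ultimately show ?thesis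
      using DERIV_imp_deriv[OF holomorphic_vec_line[of x 0 v i]] by simp
  qed
  have "norm (fderiv f x v) \<le> (\<Sum>i\<in>UNIV. norm (fderiv f x v $ i))"
    by (simp add: norm_vec_def L2_set_le_sum)
  also have "\<dots> \<le> (\<Sum>i\<in>(UNIV::'m set). M / s)"
    by (intro sum_mono nn)
  finally show ?thesis
    by (simp add: s_def field_simps)
qed

text \<open>Each point of \<open>cball x r\<close> has a ball of radius \<open>r\<close> inside
  \<open>cball x (2 * r)\<close>, so the Cauchy estimate is uniform. The constant depends on
  \<open>f\<close> only through \<open>M\<close>, which makes bounded families
  equicontinuous.\<close>

lemma holomorphic_vec_lipschitz:
  fixes M r :: real
  assumes r: "r > 0" and sub: "cball x (2 * r) \<subseteq> D" and le: "\<And>y. y \<in> cball x (2 * r) \<Longrightarrow> norm (f y) \<le> M"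
    and y: "y \<in> cball x r" and z: "z \<in> cball x r"
  shows "norm (f y - f z) \<le> CARD('m) * M / r * norm (y - z)"
proof (rule differentiable_bound[where S = "cball x r" and f' = "fderiv f"])
  have M: "0 \<le> M"
    using le[of x] r norm_ge_zero[of "f x"] by (simp del: norm_ge_zero)
  fix p assume p: "p \<in> cball x r"
  have cb: "cball p r \<subseteq> cball x (2 * r)"
    using p by (simp add: cball_subset_cball_iff dist_commute)
  have "p \<in> cball p r" using r by simp
  then have "p \<in> D" using cb sub by blast
  then show "(f has_derivative fderiv f p) (at p within cball x r)"
    using has_derivative_at_withinI holomorphic_vec_has_derivative by blast
  have "norm (fderiv f p v) \<le> CARD('m) * M / r * norm v" for v
    using r order_trans[OF cb sub] le[OF subsetD[OF cb]] by (rule holomorphic_vec_Cauchy_estimate)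
  then show "onorm (fderiv f p) \<le> CARD('m) * M / r"
    using M r by (intro onorm_bound) auto
qed (use y z in auto)

end

lemma holomorphic_vec_onI:
  assumes "\<And>x. x \<in> D \<Longrightarrow> (f has_derivative F x) (at x)" "\<And>x. x \<in> D \<Longrightarrow> clinear (F x)"
  shows "holomorphic_vec_on f D"
  unfolding holomorphic_vec_on_def using assms has_derivative_at_withinI by blast

lemma holomorphic_vec_on_subset: "holomorphic_vec_on f D \<Longrightarrow> E \<subseteq> D \<Longrightarrow> holomorphic_vec_on f E"
  unfolding holomorphic_vec_on_def by (meson has_derivative_subset subsetD)

section \<open>Closure properties of holomorphic maps\<close>

lemma clinear_comb:
  fixes f g :: "complex ^ 'n \<Rightarrow> complex ^ 'm"
  shows "clinear f \<Longrightarrow> clinear g \<Longrightarrow> clinear (\<lambda>x. a *s f x + b *s g x)"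
  by (auto simp: clinear_iff algebra_simps vector_add_ldistrib vector_smult_assoc)

lemma bounded_linear_smult_right: "bounded_linear (\<lambda>v. c *s v)" for c :: complex
  by (rule bounded_linear_intro[where K = "norm c"])
     (auto simp: vec_eq_iff algebra_simps norm_vector_smult)

lemma holomorphic_vec_on_comb:
  assumes f: "holomorphic_vec_on f D" and g: "holomorphic_vec_on g D" and D: "open D"
  shows "holomorphic_vec_on (\<lambda>x. a *s f x + b *s g x) D"
  by (rule holomorphic_vec_onI[where F = "\<lambda>x v. a *s fderiv f x v + b *s fderiv g x v"])
     (intro derivative_intros bounded_linear.has_derivative[OF bounded_linear_smult_right] clinear_comb
       holomorphic_vec_has_derivative[OF f D] holomorphic_vec_has_derivative[OF g D]
       holomorphic_vec_clinear[OF f D] holomorphic_vec_clinear[OF g D]; assumption)+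

lemma holomorphic_vec_on_diff:
  assumes "holomorphic_vec_on f D" "holomorphic_vec_on g D" "open D"
  shows "holomorphic_vec_on (\<lambda>x. f x - g x) D"
  using holomorphic_vec_on_comb[OF assms, of 1 "-1"]
  by (simp add: vector_sneg_minus1[symmetric])

lemma clinear_compose:
  fixes f :: "complex ^ 'n \<Rightarrow> complex ^ 'm" and g :: "complex ^ 'k \<Rightarrow> complex ^ 'n"
  shows "clinear f \<Longrightarrow> clinear g \<Longrightarrow> clinear (\<lambda>x. f (g x))"
  by (auto simp: clinear_iff)

lemma clinear_imp_linear: 
  assumes "clinear f" shows "linear f"
proof (rule linearI)
  show "f (r *\<^sub>R x) = r *\<^sub>R f x" for r x
    using clinear_scale[OF assms, of "of_real r" x] by (simp only: of_real_smult)
qed (use assms in \<open>simp add: clinear_iff\<close>)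

lemma holomorphic_vec_on_compose:
  assumes f: "holomorphic_vec_on f E" "open E" and g: "holomorphic_vec_on g D" "open D"
    and sub: "\<And>x. x \<in> D \<Longrightarrow> g x \<in> E"
  shows "holomorphic_vec_on (\<lambda>x. f (g x)) D"
proof (rule holomorphic_vec_onI)
  fix x assume x: "x \<in> D"
  show "((\<lambda>x. f (g x)) has_derivative (\<lambda>v. fderiv f (g x) (fderiv g x v))) (at x)"
    by (rule has_derivative_compose[OF holomorphic_vec_has_derivative[OF g x]
          holomorphic_vec_has_derivative[OF f sub[OF x]]])
  show "clinear (\<lambda>v. fderiv f (g x) (fderiv g x v))"
    by (rule clinear_compose[OF holomorphic_vec_clinear[OF f sub[OF x]] holomorphic_vec_clinear[OF g x]])
qed

lemma clinear_has_derivative: 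
  fixes A :: "complex ^ 'n \<Rightarrow> complex ^ 'm"
  shows "clinear A \<Longrightarrow> (A has_derivative A) F"
  using bounded_linear_imp_has_derivative clinear_imp_linear linear_conv_bounded_linear by blast

lemma clinear_id: "clinear (\<lambda>x. x :: complex ^ 'n)"
  by (rule clinearI) auto

lemma holomorphic_vec_on_clinear: 
  fixes A :: "complex ^ 'n \<Rightarrow> complex ^ 'm"
  shows "clinear A \<Longrightarrow> holomorphic_vec_on A D"
  by (rule holomorphic_vec_onI[where F = "\<lambda>_. A"]) (auto intro: clinear_has_derivative)

lemma holomorphic_vec_on_translate:
  "holomorphic_vec_on (\<lambda>x::complex^'n. x + c) D"
  by (rule holomorphic_vec_onI[where F = "\<lambda>_ v. v"]) (auto intro!: derivative_eq_intros clinear_id)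

section \<open>Zero sets\<close>

lemma open_imp_fsigma:
  fixes S :: "'a::euclidean_space set"
  assumes "open S"
  shows "fsigma S"
proof -
  obtain C where "\<And>n. compact (C (n::nat))" "\<Union>(range C) = S"
    using open_Union_compact_subsets[OF assms] by metis
  then show ?thesis
    unfolding fsigma_Union_compact by (intro exI[of _ C]) auto
qed

text \<open>A real ray lies in a complex line, and a coordinate that is nonzero at \<open>q\<close>
  restricts to a one-variable holomorphic function on a disc that does not vanish
  identically.\<close>

lemma countable_zeros_on_ray:
  fixes h :: "complex ^ 'n \<Rightarrow> complex ^ 'm"
  assumes h: "holomorphic_vec_on h D" "open D" and sub: "ball q R \<subseteq> D" and "h q \<noteq> 0"
  shows "countable {t::real. q + t *\<^sub>R w \<in> ball q R \<and> h (q + t *\<^sub>R w) = 0}"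
proof (cases "w = 0")
  case True
  then show ?thesis using \<open>h q \<noteq> 0\<close> by simp
next
  case False
  obtain i where i: "h q $ i \<noteq> 0"
    using \<open>h q \<noteq> 0\<close> by (auto simp: vec_eq_iff)
  define U :: "complex set" where "U = ball 0 (R / norm w)"
  define \<phi> where "\<phi> = (\<lambda>\<tau>. h (q + \<tau> *s w) $ i)"
  have U: "\<tau> \<in> U \<longleftrightarrow> q + \<tau> *s w \<in> ball q R" for \<tau>
    using False by (simp add: U_def dist_norm norm_vector_smult field_simps)
  have hol: "\<phi> holomorphic_on U"
    unfolding \<phi>_def using U sub by (intro holomorphic_vec_on_line[OF h]) auto
  have cnt: "countable {\<tau> \<in> U. \<phi> \<tau> = 0}"
  proof (cases "\<phi> constant_on U")
    case True
    have "\<phi> \<tau> = \<phi> 0" if "\<tau> \<in> U" for \<tau>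
      proof -
      have "0 \<in> U" using that by (auto simp: U_def intro: le_less_trans[OF norm_ge_zero])
      then show ?thesis using that True unfolding constant_on_def by metis
    qed
    moreover have "\<phi> 0 \<noteq> 0" using i by (simp add: \<phi>_def)
    ultimately have "{\<tau> \<in> U. \<phi> \<tau> = 0} = {}" by auto
    then show ?thesis by (metis countable_empty)
  next
    case False
    then show ?thesis
      using hol by (intro holomorphic_countable_zeros) (auto simp: U_def open_imp_fsigma)
  qed
  have "complex_of_real ` {t. q + t *\<^sub>R w \<in> ball q R \<and> h (q + t *\<^sub>R w) = 0} \<subseteq> {\<tau> \<in> U. \<phi> \<tau> = 0}"
    by (auto simp: U \<phi>_def of_real_smult)
  then have "countable (complex_of_real ` {t. q + t *\<^sub>R w \<in> ball q R \<and> h (q + t *\<^sub>R w) = 0})"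
    using cnt countable_subset by blast
  then show ?thesis
    by (rule countable_image_inj_on) (simp add: inj_on_def)
qed

text \<open>A substitute for polar coordinates: Fubini for the family of homotheties with centre
  \<open>q\<close>. For every \<open>x\<close> almost every ratio \<open>t\<close> avoids
  \<open>A\<close>, so some \<open>t\<close> avoids \<open>A\<close> for almost every
  \<open>x\<close>; then \<open>A\<close> is the image of a null set under that homothety.\<close>

lemma negligible_countable_on_rays:
  fixes A :: "'a::euclidean_space set"
  assumes A: "A \<in> sets borel" and cnt: "\<And>w. countable {t::real. q + t *\<^sub>R w \<in> A}"
  shows "negligible A"
proof -
  let ?g = "\<lambda>(t::real, x). q + t *\<^sub>R (x - q)"
  have g: "?g \<in> borel_measurable borel"
    by (intro borel_measurable_continuous_onI) (auto intro!: continuous_intros simp: case_prod_unfold)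
  have "AE t::real in lborel. AE x in lborel. q + t *\<^sub>R (x - q) \<notin> A"
  proof (subst lborel_pair.AE_commute)
    have "?g -` (- A) \<inter> space borel \<in> sets borel"
      using A by (intro measurable_sets[OF g]) auto
    moreover have "?g -` (- A) \<inter> space borel =
        {z \<in> space (lborel \<Otimes>\<^sub>M lborel). q + fst z *\<^sub>R (snd z - q) \<notin> A}"
      by (auto simp: space_pair_measure)
    ultimately show "{z \<in> space (lborel \<Otimes>\<^sub>M lborel). q + fst z *\<^sub>R (snd z - q) \<notin> A} \<in> sets (lborel \<Otimes>\<^sub>M lborel)"
      by (simp only: borel_prod sets_pair_measure_cong[OF sets_lborel sets_lborel])
    show "AE x in lborel. AE t::real in lborel. q + t *\<^sub>R (x - q) \<notin> A"
    proof (rule AE_I2)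
      fix x :: 'a
      show "AE t::real in lborel. q + t *\<^sub>R (x - q) \<notin> A"
        using AE_not_in[OF countable_imp_null_set_lborel[OF cnt[of "x - q"]]] by simp
    qed
  qed
  \<comment> \<open>The interval has positive measure and excludes \<open>t = 0\<close>, where the
    homothety is not invertible.\<close>
  moreover have "\<not> (AE t::real in lborel. t \<notin> {0<..<1})"
    using AE_iff_null_sets[of "{0<..<1::real}" lborel] by (auto simp: null_sets_def)
  ultimately obtain t :: real where t: "t > 0" and ae: "AE x in lborel. q + t *\<^sub>R (x - q) \<notin> A"
    by (smt (verit, del_insts) AE_mp AE_I2 greaterThanLessThan_iff eventually_mono)
  define N where "N = {x. q + t *\<^sub>R (x - q) \<in> A}"
  have "(\<lambda>x. q + t *\<^sub>R (x - q)) -` A \<inter> space borel \<in> sets borel"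
    using A by (intro measurable_sets[OF borel_measurable_continuous_onI] continuous_intros)
  then have "N \<in> sets borel"
    by (simp add: N_def vimage_def)
  then have "N \<in> null_sets lborel"
    using ae AE_iff_null_sets[of N lborel] by (simp add: N_def)
  then have "negligible N"
    using null_sets_completionI negligible_iff_null_sets by blast
  then have "negligible ((\<lambda>x. q + t *\<^sub>R (x - q)) ` N)"
    by (intro negligible_differentiable_image_negligible) (auto intro!: derivative_intros)
  moreover have "A \<subseteq> (\<lambda>x. q + t *\<^sub>R (x - q)) ` N"
  proof
    fix y assume "y \<in> A"
    then show "y \<in> (\<lambda>x. q + t *\<^sub>R (x - q)) ` N"
      using t by (intro image_eqI[where x = "q + (1 / t) *\<^sub>R (y - q)"]) (auto simp: N_def)
  qed
  ultimately show ?thesis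
    using negligible_subset by blast
qed

lemma negligible_zeros_ball:
  fixes h :: "complex ^ 'n \<Rightarrow> complex ^ 'm"
  assumes h: "holomorphic_vec_on h D" "open D" and sub: "ball q R \<subseteq> D" and "h q \<noteq> 0"
  shows "negligible {x \<in> ball q R. h x = 0}"
proof (rule negligible_countable_on_rays[where q = q])
  have "continuous_on (ball q R) h"
    using holomorphic_vec_continuous_on[OF h] sub continuous_on_subset by blast
  then have "closedin (top_of_set (ball q R)) (ball q R \<inter> h -` {0})"
    by (intro continuous_closedin_preimage) auto
  then obtain T where "closed T" "ball q R \<inter> h -` {0} = ball q R \<inter> T"
    by (metis closedin_closed)
  moreover have "{x \<in> ball q R. h x = 0} = ball q R \<inter> h -` {0}" by auto
  ultimately show "{x \<in> ball q R. h x = 0} \<in> sets borel"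
    by simp
  show "countable {t::real. q + t *\<^sub>R w \<in> {x \<in> ball q R. h x = 0}}" for w
    using countable_zeros_on_ray[OF h sub \<open>h q \<noteq> 0\<close>, of w] by simp
qed

text \<open>Being locally null spreads through the connected set: a null set misses a point in every
  small ball, and such a point is a new centre for \<open>negligible_zeros_ball\<close>.\<close>

lemma negligible_zeros:
  fixes h :: "complex ^ 'n \<Rightarrow> complex ^ 'm"
  assumes h: "holomorphic_vec_on h D" and D: "open D" "connected D" and q: "q \<in> D" "h q \<noteq> 0"
  shows "negligible {x \<in> D. h x = 0}"
proof -
  define Z where "Z = {x \<in> D. h x = 0}"
  define P where "P = (\<lambda>x. \<exists>s>0. negligible (Z \<inter> ball x s))"
  have near: "P y" if "ball c R \<subseteq> D" "h c \<noteq> 0" "dist c y < R" for c y R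
  proof -
    have "ball y (R - dist c y) \<subseteq> ball c R"
      by (simp add: ball_subset_ball_iff dist_commute)
    then have "Z \<inter> ball y (R - dist c y) \<subseteq> {x \<in> ball c R. h x = 0}"
      by (auto simp: Z_def)
    then have "negligible (Z \<inter> ball y (R - dist c y))"
      using negligible_zeros_ball[OF h D(1) that(1,2)] negligible_subset by blast
    then show ?thesis
      unfolding P_def using that(3) by (intro exI[of _ "R - dist c y"]) auto
  qed
  have "P q"
  proof -
    obtain R where "R > 0" "ball q R \<subseteq> D"
      using q D open_contains_ball by blast
    then show ?thesis using near[of q R q] q by simp
  qed
  have P: "P x" if "x \<in> D" for x
  proof (rule connected_induction_simple[where P = P, OF D(2) q(1) that \<open>P q\<close>])
    fix p assume "p \<in> D"
    then obtain r where r: "r > 0" "ball p r \<subseteq> D"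
      using D open_contains_ball by blast
    \<comment> \<open>The new centre \<open>c\<close> lies within \<open>r/4\<close> of
      \<open>p\<close>, so \<open>ball c (r/2)\<close> stays inside \<open>ball p r\<close> and, as
      \<open>r/4 + r/8 < r/2\<close>, contains \<open>y\<close>.\<close>
    have "P y" if x: "dist p x < r/8" and y: "dist p y < r/8" and "P x" for x y
    proof -
      obtain s where s: "s > 0" "negligible (Z \<inter> ball x s)"
        using \<open>P x\<close> by (auto simp: P_def)
      define s' where "s' = min s (r/8)"
      have "s' > 0" "s' \<le> s" "s' \<le> r/8" using s r by (auto simp: s'_def)
      have "\<not> ball x s' \<subseteq> Z"
      proof
        assume "ball x s' \<subseteq> Z"
        then have "ball x s' \<subseteq> Z \<inter> ball x s" using \<open>s' \<le> s\<close> by auto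
        then show False
          using s negligible_subset open_not_negligible[of "ball x s'"] \<open>s' > 0\<close> by auto
      qed
      then obtain c where c: "dist x c < s'" "c \<notin> Z" by (auto simp: subset_iff)
      have pc: "dist p c < r/4"
        using c x dist_triangle[of p c x] \<open>s' \<le> r/8\<close> by simp
      have "ball c (r/2) \<subseteq> ball p r"
        using pc r by (simp add: ball_subset_ball_iff dist_commute)
      moreover have "c \<in> D" using r pc by auto
      moreover have "dist c y < r/2"
        using pc y r(1) dist_triangle[of c y p] dist_commute[of c p] by linarith
      ultimately show ?thesis
        using near[of c "r/2" y] c r by (auto simp: Z_def)
    qed
    then have "\<forall>x \<in> D \<inter> ball p (r/8). \<forall>y \<in> D \<inter> ball p (r/8). P x \<longrightarrow> P y"
      by (meson IntD2 mem_ball)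
    moreover have "openin (top_of_set D) (D \<inter> ball p (r/8))" "p \<in> D \<inter> ball p (r/8)"
      using r \<open>p \<in> D\<close> by (simp_all add: openin_open_Int)
    ultimately show "\<exists>T. openin (top_of_set D) T \<and> p \<in> T \<and> (\<forall>x\<in>T. \<forall>y\<in>T. P x \<longrightarrow> P y)"
      by blast
  qed
  show ?thesis
    unfolding Z_def[symmetric]
  proof (subst locally_negligible_alt, intro ballI)
    fix x assume x: "x \<in> Z"
    then obtain s where "s > 0" "negligible (Z \<inter> ball x s)"
      using P by (auto simp: Z_def P_def)
    then show "\<exists>U. openin (top_of_set Z) U \<and> x \<in> U \<and> negligible U"
      using x by (intro exI[of _ "Z \<inter> ball x s"]) (auto simp: openin_open_Int)
  qed
qed

section \<open>Montel's theorem\<close>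

text \<open>Convergence on a finite net suffices, because the common Lipschitz bound passes to the
  limit function.\<close>

lemma uniform_limit_equi_lipschitz:
  fixes F :: "nat \<Rightarrow> 'a::metric_space \<Rightarrow> 'b::real_normed_vector"
  assumes S: "compact S" and lip: "\<And>n y z. y \<in> S \<Longrightarrow> z \<in> S \<Longrightarrow> norm (F n y - F n z) \<le> L * dist y z"
    and lim: "\<And>y. y \<in> S \<Longrightarrow> (\<lambda>n. F n y) \<longlonglongrightarrow> g y"
  shows "uniform_limit S F g sequentially"
proof (rule uniform_limitI)
  fix e :: real assume "e > 0"
  define d where "d = e / (3 * (\<bar>L\<bar> + 1))"
  have "d > 0" using \<open>e > 0\<close> by (simp add: d_def)
  have Ld: "\<bar>L\<bar> * d < e/3"
  proof -
    have "\<bar>L\<bar> * d < (\<bar>L\<bar> + 1) * d" using \<open>d > 0\<close> by (simp add: algebra_simps)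
    also have "\<dots> = e/3" by (simp add: d_def field_simps)
    finally show ?thesis .
  qed
  have lipF: "norm (F n y - F n z) \<le> \<bar>L\<bar> * dist y z" if "y \<in> S" "z \<in> S" for n y z
    using lip[OF that, of n] by (smt (verit) mult_right_mono zero_le_dist)
  have lipg: "norm (g y - g z) \<le> \<bar>L\<bar> * dist y z" if "y \<in> S" "z \<in> S" for y z
    using lipF[OF that] by (intro LIMSEQ_le_const2[OF tendsto_norm[OF tendsto_diff[OF lim lim]]] that) auto
  have "S \<subseteq> (\<Union>t\<in>S. ball t d)" using \<open>d > 0\<close> by auto
  then obtain T where T: "T \<subseteq> S" "finite T" "S \<subseteq> (\<Union>t\<in>T. ball t d)"
    using compactE_image[OF S, of S "\<lambda>t. ball t d"] by (metis open_ball)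
  have "\<forall>\<^sub>F n in sequentially. \<forall>t\<in>T. dist (F n t) (g t) < e/3"
    using T lim \<open>e > 0\<close> by (intro eventually_ball_finite ballI tendstoD lim) auto
  then show "\<forall>\<^sub>F n in sequentially. \<forall>y\<in>S. dist (F n y) (g y) < e"
  proof eventually_elim
    case (elim n)
    show ?case
    proof
      fix y assume y: "y \<in> S"
      then obtain t where t: "t \<in> T" "dist t y < d" using T by auto
      have "\<bar>L\<bar> * dist t y \<le> \<bar>L\<bar> * d" using t by (intro mult_left_mono) auto
      then have "\<bar>L\<bar> * dist t y < e/3" using Ld by simp
      moreover have "dist (F n y) (F n t) \<le> \<bar>L\<bar> * dist t y" "dist (g y) (g t) \<le> \<bar>L\<bar> * dist t y"
        using lipF[of y t n] lipg[of y t] y t T by (auto simp: dist_norm dist_commute)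
      moreover have "dist (F n t) (g t) < e/3" using elim t by blast
      ultimately show "dist (F n y) (g y) < e"
        using dist_triangle[of "F n y" "g y" "F n t"] dist_triangle[of "F n t" "g y" "g t"]
        by (simp add: dist_commute[of "g y"])
    qed
  qed
qed

lemma convergent_equi_lipschitz_dense:
  fixes F :: "nat \<Rightarrow> 'a::metric_space \<Rightarrow> 'b::banach"
  assumes lip: "\<And>n y. dist x y \<le> r \<Longrightarrow> norm (F n x - F n y) \<le> L * dist x y" and "r > 0"
    and x: "x \<in> closure Q" and conv: "\<And>q. q \<in> Q \<Longrightarrow> convergent (\<lambda>n. F n q)"
  shows "convergent (\<lambda>n. F n x)"
proof (rule Cauchy_convergent, rule CauchyI)
  fix e :: real assume "e > 0"
  define d where "d = min r (e / (3 * (\<bar>L\<bar> + 1)))"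
  have "d > 0" using \<open>e > 0\<close> \<open>r > 0\<close> by (simp add: d_def)
  then obtain q where q: "q \<in> Q" "dist q x < d"
    using x closure_approachable by blast
  have *: "norm (F n x - F n q) < e/3" for n
  proof -
    have "norm (F n x - F n q) \<le> L * dist x q"
      using q by (intro lip) (auto simp: d_def dist_commute)
    also have "\<dots> \<le> (\<bar>L\<bar> + 1) * dist x q" by (intro mult_right_mono) auto
    also have "\<dots> < (\<bar>L\<bar> + 1) * (e / (3 * (\<bar>L\<bar> + 1)))"
      using q by (intro mult_strict_left_mono) (auto simp: d_def dist_commute)
    also have "\<dots> = e/3" by (simp add: field_simps)
    finally show ?thesis .
  qed
  have "Cauchy (\<lambda>n. F n q)" using conv q convergent_Cauchy by blast
  then obtain N where N: "\<And>m n. m \<ge> N \<Longrightarrow> n \<ge> N \<Longrightarrow> norm (F m q - F n q) < e/3"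
    using CauchyD[of "\<lambda>n. F n q" "e/3"] \<open>e > 0\<close> by auto
  show "\<exists>N. \<forall>m\<ge>N. \<forall>n\<ge>N. norm (F m x - F n x) < e"
  proof (intro exI allI impI)
    fix m n assume "m \<ge> N" "n \<ge> N"
    have "F m x - F n x = (F m x - F m q) + (F m q - F n q) + (- (F n x - F n q))" by simp
    then have "norm (F m x - F n x) \<le> norm (F m x - F m q) + norm (F m q - F n q) + norm (F n x - F n q)"
      by (metis norm_minus_cancel norm_triangle_le norm_triangle_mono order_refl)
    then show "norm (F m x - F n x) < e"
      using *[of m] *[of n] N[OF \<open>m \<ge> N\<close> \<open>n \<ge> N\<close>] by simp
  qed
qed

lemma open_contains_cball_twice:
  assumes "open D" "x \<in> D"
  obtains r :: real where "r > 0" "cball x (2 * r) \<subseteq> D"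
proof -
  obtain e where "e > 0" "cball x e \<subseteq> D"
    using assms open_contains_cball by blast
  then show ?thesis using that[of "e/2"] by simp
qed

text \<open>Weierstrass' theorem. The Cauchy estimate for \<open>F m - F n\<close> makes the
  derivatives uniformly Cauchy on a smaller ball, and complex linearity survives limits.\<close>

lemma holomorphic_vec_limit:
  fixes F :: "nat \<Rightarrow> complex ^ 'n \<Rightarrow> complex ^ 'm" and M :: real
  assumes D: "open D" and hol: "\<And>n. holomorphic_vec_on (F n) D"
    and le: "\<And>n x. x \<in> D \<Longrightarrow> norm (F n x) \<le> M"
    and lim: "\<And>x. x \<in> D \<Longrightarrow> (\<lambda>n. F n x) \<longlonglongrightarrow> g x"
  shows "holomorphic_vec_on g D"
    and "\<And>x v. x \<in> D \<Longrightarrow> (\<lambda>n. fderiv (F n) x v) \<longlonglongrightarrow> fderiv g x v"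
proof -
  have "\<exists>A. (g has_derivative A) (at x) \<and> clinear A \<and> (\<forall>v. (\<lambda>n. fderiv (F n) x v) \<longlonglongrightarrow> A v)"
    if "x \<in> D" for x
  proof -
    \<comment> \<open>Room for halving twice: Lipschitz bounds hold on
      \<open>cball x (2 * r)\<close>, derivative estimates on \<open>ball x r\<close>.\<close>
    obtain r where r: "r > 0" "cball x (2 * (2 * r)) \<subseteq> D"
    proof -
      obtain e where "e > 0" "cball x (2 * e) \<subseteq> D"
        using open_contains_cball_twice D \<open>x \<in> D\<close> by blast
      then show ?thesis using that[of "e/2"] by simp
    qed
    define C where "C = real CARD('m)"
    have "C > 0" by (simp add: C_def)
    have inD: "y \<in> D" if "y \<in> cball x (2 * r)" for y
      using that r by (auto intro!: subsetD[OF r(2)])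
    have lip: "norm (F n y - F n z) \<le> (C * M / (2 * r)) * dist y z"
      if "y \<in> cball x (2 * r)" "z \<in> cball x (2 * r)" for n y z
      unfolding dist_norm C_def using r that le by (intro holomorphic_vec_lipschitz[OF hol D]) auto
    have unif: "uniform_limit (cball x (2 * r)) F g sequentially"
      using lim inD by (intro uniform_limit_equi_lipschitz[OF compact_cball lip]) auto
    have diff: "norm (fderiv (F m) y v - fderiv (F n) y v) \<le> C * e / r * norm v"
      if y: "y \<in> ball x r" and e: "\<And>z. z \<in> cball x (2 * r) \<Longrightarrow> norm (F m z - F n z) \<le> e" for y v m n e
    proof -
      have sub: "cball y r \<subseteq> cball x (2 * r)"
        using y by (simp add: cball_subset_cball_iff dist_commute)
      have yD: "y \<in> D" using y r by (intro inD) auto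
      have "norm (fderiv (\<lambda>z. F m z - F n z) y v) \<le> C * e / r * norm v"
        unfolding C_def using sub inD e r
        by (intro holomorphic_vec_Cauchy_estimate[OF holomorphic_vec_on_diff[OF hol hol D] D]) auto
      moreover have "fderiv (\<lambda>z. F m z - F n z) y = (\<lambda>v. fderiv (F m) y v - fderiv (F n) y v)"
        by (rule frechet_derivative_at[symmetric])
           (intro has_derivative_diff holomorphic_vec_has_derivative[OF hol D yD])
      ultimately show ?thesis by simp
    qed
    have unifC: "\<exists>N. \<forall>m\<ge>N. \<forall>n\<ge>N. \<forall>y\<in>ball x r. \<forall>v. norm (fderiv (F m) y v - fderiv (F n) y v) \<le> e * norm v"
      if "e > 0" for e :: real
    proof -
      \<comment> \<open>Chosen so that the bound \<open>2 * d\<close> on \<open>F m - F n\<close>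
        turns into exactly \<open>e\<close> in the Cauchy estimate.\<close>
      define d where "d = e * r / (2 * C)"
      have "d > 0" using that r \<open>C > 0\<close> by (simp add: d_def)
      obtain N where N: "\<And>n z. n \<ge> N \<Longrightarrow> z \<in> cball x (2 * r) \<Longrightarrow> dist (F n z) (g z) < d"
        using uniform_limitD[OF unif \<open>d > 0\<close>] unfolding eventually_sequentially by blast
      have "norm (F m z - F n z) \<le> 2 * d" if "m \<ge> N" "n \<ge> N" "z \<in> cball x (2 * r)" for m n z
        using N[OF that(1,3)] N[OF that(2,3)] dist_triangle2[of "F m z" "F n z" "g z"]
        by (simp add: dist_norm)
      then have "norm (fderiv (F m) y v - fderiv (F n) y v) \<le> C * (2 * d) / r * norm v"
        if "m \<ge> N" "n \<ge> N" "y \<in> ball x r" for m n y v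
        using that by (intro diff) auto
      moreover have "C * (2 * d) / r = e" using r \<open>C > 0\<close> by (simp add: d_def)
      ultimately show ?thesis by metis
    qed
    define G where "G = (\<lambda>y v. lim (\<lambda>n. fderiv (F n) y v))"
    have G: "(\<lambda>n. fderiv (F n) y v) \<longlonglongrightarrow> G y v" if y: "y \<in> ball x r" for y v
    proof -
      have "Cauchy (\<lambda>n. fderiv (F n) y v)"
      proof (rule CauchyI)
        fix e :: real assume "e > 0"
        define e' where "e' = e / (norm v + 1)"
        have "e' > 0" using \<open>e > 0\<close> by (simp add: e'_def add_nonneg_pos)
        have "norm v * e' < (norm v + 1) * e'" using \<open>e' > 0\<close> by simp
        also have "\<dots> = e" using norm_ge_zero[of v] by (simp add: e'_def del: norm_ge_zero)
        finally have "e' * norm v < e" by (simp add: mult.commute)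
        then show "\<exists>N. \<forall>m\<ge>N. \<forall>n\<ge>N. norm (fderiv (F m) y v - fderiv (F n) y v) < e"
          using unifC[OF \<open>e' > 0\<close>] y by (meson le_less_trans)
      qed
      then show ?thesis
        unfolding G_def using Cauchy_convergent convergent_LIMSEQ_iff by blast
    qed
    have "\<exists>h. \<forall>y\<in>ball x r. (\<lambda>n. F n y) \<longlonglongrightarrow> h y \<and> (h has_derivative G y) (at y within ball x r)"
    proof (rule has_derivative_sequence[where f' = "\<lambda>n. fderiv (F n)" and ?x0.0 = x])
      show "(F n has_derivative fderiv (F n) y) (at y within ball x r)" if "y \<in> ball x r" for n y
        using inD[of y] that r has_derivative_at_withinI holomorphic_vec_has_derivative[OF hol D] by fastforce
      show "\<forall>\<^sub>F n in sequentially. \<forall>y\<in>ball x r. \<forall>v. norm (fderiv (F n) y v - G y v) \<le> e * norm v"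
        if "e > 0" for e
      proof -
        obtain N where N: "\<And>m n y v. m \<ge> N \<Longrightarrow> n \<ge> N \<Longrightarrow> y \<in> ball x r
            \<Longrightarrow> norm (fderiv (F m) y v - fderiv (F n) y v) \<le> e * norm v"
          using unifC \<open>e > 0\<close> by meson
        have "norm (fderiv (F n) y v - G y v) \<le> e * norm v" if "n \<ge> N" "y \<in> ball x r" for n y v
          using N[OF that(1) _ that(2)]
          by (intro LIMSEQ_le_const2[OF tendsto_norm[OF tendsto_diff[OF tendsto_const G[OF that(2)]]]]) auto
        then show ?thesis
          unfolding eventually_sequentially by blast
      qed
      show "x \<in> ball x r" using r by simp
      show "(\<lambda>n. F n x) \<longlonglongrightarrow> g x" using lim \<open>x \<in> D\<close> by blast
    qed simp
    then obtain h where h: "\<And>y. y \<in> ball x r \<Longrightarrow> (\<lambda>n. F n y) \<longlonglongrightarrow> h y"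
        "\<And>y. y \<in> ball x r \<Longrightarrow> (h has_derivative G y) (at y within ball x r)"
      by blast
    have hg: "h y = g y" if "y \<in> ball x r" for y
      using LIMSEQ_unique[OF h(1)[OF that] lim] inD[of y] that r(1) by auto
    have xr: "x \<in> ball x r" using r by simp
    have "(g has_derivative G x) (at x within ball x r)"
      using has_derivative_transform[OF xr hg[symmetric] h(2)[OF xr]] by simp
    then have "(g has_derivative G x) (at x)"
      using at_within_open[OF xr open_ball] by simp
    moreover have "clinear (G x)"
    proof (rule clinearI)
      have lin: "clinear (fderiv (F n) x)" for n
        using holomorphic_vec_clinear[OF hol D \<open>x \<in> D\<close>] .
      show "G x (u + v) = G x u + G x v" for u v
        using tendsto_add[OF G[OF xr, of u] G[OF xr, of v]] G[OF xr, of "u + v"] lin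
        by (simp add: clinear_iff LIMSEQ_unique)
      have "(\<lambda>n. c *s fderiv (F n) x v) \<longlonglongrightarrow> c *s G x v" for c v
        by (intro bounded_linear.tendsto[OF bounded_linear_smult_right] G xr)
      then show "G x (c *s v) = c *s G x v" for c v
        using LIMSEQ_unique[OF G[OF xr, of "c *s v"]] clinear_scale[OF lin] by simp
    qed
    ultimately show ?thesis using G[OF xr] by blast
  qed
  then obtain A where A: "\<And>x. x \<in> D \<Longrightarrow> (g has_derivative A x) (at x)" "\<And>x. x \<in> D \<Longrightarrow> clinear (A x)"
    "\<And>x v. x \<in> D \<Longrightarrow> (\<lambda>n. fderiv (F n) x v) \<longlonglongrightarrow> A x v" by metis
  then show "holomorphic_vec_on g D"
    using holomorphic_vec_onI by blast
  show "(\<lambda>n. fderiv (F n) x v) \<longlonglongrightarrow> fderiv g x v" if "x \<in> D" for x v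
    using A(3)[OF that] frechet_derivative_at[OF A(1)[OF that]] by simp
qed

text \<open>A diagonal subsequence converges on a countable dense set, and the uniform local
  Lipschitz bounds carry convergence to all of \<open>D\<close>. The derivatives are included so
  that a normalisation of the derivative at a point survives the limit.\<close>

lemma Montel_vec:
  fixes F :: "nat \<Rightarrow> complex ^ 'n \<Rightarrow> complex ^ 'm" and M :: real
  assumes D: "open D" and hol: "\<And>n. holomorphic_vec_on (F n) D"
    and le: "\<And>n x. x \<in> D \<Longrightarrow> norm (F n x) \<le> M"
  obtains g k where "strict_mono (k :: nat \<Rightarrow> nat)" "holomorphic_vec_on g D"
    "\<And>x. x \<in> D \<Longrightarrow> (\<lambda>n. F (k n) x) \<longlonglongrightarrow> g x"
    "\<And>x v. x \<in> D \<Longrightarrow> (\<lambda>n. fderiv (F (k n)) x v) \<longlonglongrightarrow> fderiv g x v"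
proof -
  obtain Q where Q: "countable Q" "Q \<subseteq> D" "D \<subseteq> closure Q"
    using separable[of D] by blast
  obtain k where k: "strict_mono (k :: nat \<Rightarrow> nat)" "\<And>x. x \<in> Q \<Longrightarrow> \<exists>l. (\<lambda>n. F (k n) x) \<longlonglongrightarrow> l"
    using function_convergent_subsequence[OF Q(1), of F M] le Q by blast
  have "convergent (\<lambda>n. F (k n) x)" if "x \<in> D" for x
  proof -
    obtain r where r: "r > 0" "cball x (2 * r) \<subseteq> D"
      using open_contains_cball_twice D \<open>x \<in> D\<close> by blast
    show ?thesis
    proof (rule convergent_equi_lipschitz_dense[of x r _ _ Q])
      show "norm (F (k n) x - F (k n) y) \<le> (CARD('m) * M / r) * dist x y" if "dist x y \<le> r" for n y
        unfolding dist_norm using that r le by (intro holomorphic_vec_lipschitz[OF hol D]) auto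
    qed (use r Q that k in \<open>auto simp: convergent_def\<close>)
  qed
  then have *: "(\<lambda>n. F (k n) x) \<longlonglongrightarrow> lim (\<lambda>n. F (k n) x)" if "x \<in> D" for x
    using that convergent_LIMSEQ_iff by blast
  show ?thesis
    using holomorphic_vec_limit[of D "\<lambda>n. F (k n)" M "\<lambda>x. lim (\<lambda>n. F (k n) x)", OF D hol le *] k(1) *
    by (intro that[of k "\<lambda>x. lim (\<lambda>n. F (k n) x)"]) blast+
qed

section \<open>Limits of automorphisms\<close>

lemma holomorphic_vec_on_cong:
  assumes "\<And>x. x \<in> D \<Longrightarrow> f x = g x"
  shows "holomorphic_vec_on f D \<longleftrightarrow> holomorphic_vec_on g D"
  unfolding holomorphic_vec_on_def using assms
  by (smt (verit) has_derivative_transform)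

lemma holomorphic_automorphismI:
  assumes "holomorphic_vec_on f D" "holomorphic_vec_on g D"
    and "\<And>x. x \<in> D \<Longrightarrow> f x \<in> D" "\<And>x. x \<in> D \<Longrightarrow> g x \<in> D"
    and "\<And>x. x \<in> D \<Longrightarrow> g (f x) = x" "\<And>x. x \<in> D \<Longrightarrow> f (g x) = x"
  shows "holomorphic_automorphism D f"
proof -
  have bij: "bij_betw f D D"
    using assms by (intro bij_betwI[where g = g]) auto
  have "inv_into D f x = g x" if "x \<in> D" for x
    using that assms bij by (metis bij_betw_inv_into_left)
  then show ?thesis
    using bij assms holomorphic_vec_on_cong[of D "inv_into D f" g]
    unfolding holomorphic_automorphism_def by blast
qed

lemma holomorphic_automorphism_inv:
  assumes "holomorphic_automorphism D f"
  shows "holomorphic_automorphism D (inv_into D f)"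
    and "\<And>x. x \<in> D \<Longrightarrow> f x \<in> D" "\<And>x. x \<in> D \<Longrightarrow> inv_into D f x \<in> D"
    and "\<And>x. x \<in> D \<Longrightarrow> inv_into D f (f x) = x" "\<And>x. x \<in> D \<Longrightarrow> f (inv_into D f x) = x"
proof -
  have bij: "bij_betw f D D" and hol: "holomorphic_vec_on f D" "holomorphic_vec_on (inv_into D f) D"
    using assms by (auto simp: holomorphic_automorphism_def)
  show 1: "f x \<in> D" "inv_into D f x \<in> D" "inv_into D f (f x) = x" "f (inv_into D f x) = x"
    if "x \<in> D" for x
    using bij that
    by (auto simp: bij_betw_apply bij_betw_inv_into_left bij_betw_inv_into_right intro: bij_betw_apply[OF bij_betw_inv_into])
  show "holomorphic_automorphism D (inv_into D f)"
    using hol 1 by (intro holomorphic_automorphismI[where g = f])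
qed

lemma holomorphic_automorphism_id: "holomorphic_automorphism D (\<lambda>x. x)"
  by (rule holomorphic_automorphismI[where g = "\<lambda>x. x"]) (auto intro: holomorphic_vec_on_clinear clinear_id)

lemma holomorphic_automorphism_compose:
  assumes "open D" and f: "holomorphic_automorphism D f" and g: "holomorphic_automorphism D g"
  shows "holomorphic_automorphism D (\<lambda>x. f (g x))"
proof (rule holomorphic_automorphismI[where g = "\<lambda>x. inv_into D g (inv_into D f x)"])
  have hol: "holomorphic_vec_on f D" "holomorphic_vec_on g D"
      "holomorphic_vec_on (inv_into D f) D" "holomorphic_vec_on (inv_into D g) D"
    using f g by (simp_all add: holomorphic_automorphism_def)
  show "holomorphic_vec_on (\<lambda>x. f (g x)) D"
    by (rule holomorphic_vec_on_compose[OF hol(1) assms(1) hol(2) assms(1)])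
      (rule holomorphic_automorphism_inv(2)[OF g])
  show "holomorphic_vec_on (\<lambda>x. inv_into D g (inv_into D f x)) D"
    by (rule holomorphic_vec_on_compose[OF hol(4) assms(1) hol(3) assms(1)])
      (rule holomorphic_automorphism_inv(3)[OF f])
qed (simp_all add: holomorphic_automorphism_inv[OF f] holomorphic_automorphism_inv[OF g])

section \<open>Automorphisms of a bounded domain and an invariant distance\<close>

locale bounded_domain_vec =
  fixes D :: "(complex ^ 'n) set" and R :: real
  assumes open_D: "open D" and connected_D: "connected D" and norm_le_R: "\<And>x. x \<in> D \<Longrightarrow> norm x \<le> R"
begin

abbreviation Aut :: "(complex ^ 'n \<Rightarrow> complex ^ 'n) set"
  where "Aut \<equiv> Collect (holomorphic_automorphism D)"

lemma Aut_holomorphic: "f \<in> Aut \<Longrightarrow> holomorphic_vec_on f D"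
  by (simp add: holomorphic_automorphism_def)

lemmas Aut_inv = holomorphic_automorphism_inv(1)[of D, folded mem_Collect_eq[of _ "holomorphic_automorphism D"]]
lemmas Aut_maps = holomorphic_automorphism_inv(2-)[of D, folded mem_Collect_eq[of _ "holomorphic_automorphism D"]]

lemma Aut_id: "(\<lambda>x. x) \<in> Aut"
  by (simp add: holomorphic_automorphism_id)

lemma Aut_compose: "f \<in> Aut \<Longrightarrow> g \<in> Aut \<Longrightarrow> (\<lambda>x. f (g x)) \<in> Aut"
  by (simp add: holomorphic_automorphism_compose open_D)

text \<open>
  By the Cauchy estimates this is a metric inducing the Euclidean topology of \<open>D\<close>; it is invariant
  under automorphisms by construction, which makes it a substitute for the Caratheodory metric.
\<close>

definition adist :: "complex ^ 'n \<Rightarrow> complex ^ 'n \<Rightarrow> real"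
  where "adist x y = (SUP g\<in>Aut. norm (g x - g y))"

lemma norm_Aut_le: "g \<in> Aut \<Longrightarrow> x \<in> D \<Longrightarrow> norm (g x) \<le> R"
  by (simp add: Aut_maps norm_le_R)

text \<open>Boundedness of \<open>D\<close> keeps the supremum finite; \<open>SUP\<close> over an
  unbounded set of reals would carry no information.\<close>

lemma le_adist:
  assumes "g \<in> Aut" "x \<in> D" "y \<in> D"
  shows "norm (g x - g y) \<le> adist x y"
proof -
  have "norm (h x - h y) \<le> 2 * R" if "h \<in> Aut" for h
    using norm_Aut_le[OF that assms(2)] norm_Aut_le[OF that assms(3)] norm_triangle_ineq4[of "h x" "h y"]
    by linarith
  then show ?thesis
    unfolding adist_def using assms by (intro cSUP_upper bdd_aboveI2[where M = "2 * R"]) auto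
qed

lemma adist_le:
  assumes "\<And>g. g \<in> Aut \<Longrightarrow> norm (g x - g y) \<le> c"
  shows "adist x y \<le> c"
  unfolding adist_def using Aut_id assms by (intro cSUP_least) auto

lemma dist_le_adist: "x \<in> D \<Longrightarrow> y \<in> D \<Longrightarrow> dist x y \<le> adist x y"
  using le_adist[OF Aut_id] by (simp add: dist_norm)

lemma adist_nonneg: "x \<in> D \<Longrightarrow> y \<in> D \<Longrightarrow> 0 \<le> adist x y"
  using dist_le_adist zero_le_dist order_trans by blast

lemma adist_commute: "adist x y = adist y x"
  by (simp add: adist_def norm_minus_commute)

lemma adist_triangle:
  assumes "x \<in> D" "y \<in> D" "z \<in> D"
  shows "adist x z \<le> adist x y + adist y z"
proof (rule adist_le)
  fix g assume "g \<in> Aut"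
  then show "norm (g x - g z) \<le> adist x y + adist y z"
    using le_adist[of g x y] le_adist[of g y z] assms norm_triangle_ineq[of "g x - g y" "g y - g z"]
    by simp
qed

text \<open>Precomposition with \<open>f\<close> sends \<open>Aut\<close> into itself, so the left
  supremum ranges over part of the right one.\<close>

lemma adist_Aut_le:
  assumes "f \<in> Aut" "x \<in> D" "y \<in> D"
  shows "adist (f x) (f y) \<le> adist x y"
  using le_adist[OF Aut_compose[OF _ assms(1)] assms(2,3)] by (rule adist_le)

lemma adist_Aut:
  assumes "f \<in> Aut" "x \<in> D" "y \<in> D"
  shows "adist (f x) (f y) = adist x y"
  using adist_Aut_le[OF assms] adist_Aut_le[OF Aut_inv[OF assms(1)], of "f x" "f y"] assms
  by (simp add: Aut_maps)

lemma adist_lipschitz: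
  assumes "r > 0" "cball x (2 * r) \<subseteq> D" "y \<in> cball x r"
  shows "adist x y \<le> (CARD('n) * R / r) * dist x y"
proof (rule adist_le)
  fix g assume g: "g \<in> Aut"
  show "norm (g x - g y) \<le> (CARD('n) * R / r) * dist x y"
    unfolding dist_norm using assms norm_Aut_le[OF g]
    by (intro holomorphic_vec_lipschitz[OF Aut_holomorphic[OF g] open_D]) auto
qed

lemma adist_tendsto:
  assumes "y \<in> D" and Y: "(Y \<longlongrightarrow> y) F"
  shows "((\<lambda>k. adist y (Y k)) \<longlongrightarrow> 0) F"
proof -
  obtain r where r: "r > 0" "cball y (2 * r) \<subseteq> D"
    using open_contains_cball_twice open_D \<open>y \<in> D\<close> by blast
  have "((\<lambda>k. CARD('n) * R / r * dist y (Y k)) \<longlongrightarrow> CARD('n) * R / r * dist y y) F"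
    by (intro tendsto_intros Y)
  then have lim: "((\<lambda>k. CARD('n) * R / r * dist y (Y k)) \<longlongrightarrow> 0) F" by simp
  have "\<forall>\<^sub>F k in F. dist (Y k) y < r" using Y r(1) by (rule tendstoD)
  then have ev: "\<forall>\<^sub>F k in F. norm (adist y (Y k)) \<le> CARD('n) * R / r * dist y (Y k)"
  proof eventually_elim
    case (elim k)
    then have "Y k \<in> cball y r" by (simp add: dist_commute)
    moreover from this have "Y k \<in> D" using r by (auto intro!: subsetD[OF r(2)])
    ultimately show ?case
      using adist_lipschitz[OF r, of "Y k"] adist_nonneg[OF \<open>y \<in> D\<close>, of "Y k"] by simp
  qed
  show ?thesis
    by (rule Lim_null_comparison[OF ev lim])
qed

text \<open>Equicontinuity: \<open>adist\<close> dominates the displacement under all automorphisms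
  at once, so the argument may move with the index.\<close>

lemma Aut_limit_compose:
  assumes F: "\<And>k. F k \<in> Aut" and lim: "(\<lambda>k. F k y) \<longlonglongrightarrow> l"
    and Y: "Y \<longlonglongrightarrow> y" "\<And>k. Y k \<in> D" and y: "y \<in> D"
  shows "(\<lambda>k. F k (Y k)) \<longlonglongrightarrow> l"
proof -
  have "(\<lambda>k. F k y - F k (Y k)) \<longlonglongrightarrow> 0"
    by (rule Lim_null_comparison[OF _ adist_tendsto[OF y Y(1)]]) (simp add: le_adist[OF F y Y(2)])
  from tendsto_diff[OF lim this] show ?thesis by simp
qed

text \<open>As \<open>D\<close> is bounded, this is relative compactness of the ball in
  \<open>D\<close>. The admissible radius may shrink towards the boundary, but it is constant along
  orbits of \<open>Aut\<close>.\<close>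

definition relcomp_ball :: "complex ^ 'n \<Rightarrow> real \<Rightarrow> bool"
  where "relcomp_ball x \<rho> \<longleftrightarrow> closure {z \<in> D. adist x z < \<rho>} \<subseteq> D"

lemma relcomp_ball_exists:
  assumes "x \<in> D"
  obtains \<rho> where "\<rho> > 0" "relcomp_ball x \<rho>"
proof -
  obtain e where e: "e > 0" "cball x e \<subseteq> D"
    using assms open_D open_contains_cball by blast
  have "{z \<in> D. adist x z < e} \<subseteq> cball x e"
    using dist_le_adist[OF assms] by fastforce
  then have "closure {z \<in> D. adist x z < e} \<subseteq> cball x e"
    by (simp add: closure_minimal)
  then show ?thesis
    using e that[of e] by (auto simp: relcomp_ball_def)
qed

text \<open>The image under \<open>f\<close> of the compact closure is compact, hence closed in the
  whole space, lies in \<open>D\<close> and, by invariance of \<open>adist\<close>, contains the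
  ball about \<open>f x\<close>.\<close>

lemma relcomp_ball_Aut:
  assumes f: "f \<in> Aut" and x: "x \<in> D" and rc: "relcomp_ball x \<rho>"
  shows "relcomp_ball (f x) \<rho>"
proof -
  let ?B = "{z \<in> D. adist x z < \<rho>}"
  have "bounded ?B"
    using norm_le_R by (auto simp: bounded_iff)
  then have "compact (closure ?B)"
    by simp
  then have "compact (f ` closure ?B)"
    using rc holomorphic_vec_continuous_on[OF Aut_holomorphic[OF f] open_D] unfolding relcomp_ball_def
    by (meson compact_continuous_image continuous_on_subset)
  moreover have "{z \<in> D. adist (f x) z < \<rho>} \<subseteq> f ` closure ?B"
  proof
    fix z assume z: "z \<in> {z \<in> D. adist (f x) z < \<rho>}"
    then have "inv_into D f z \<in> ?B"
      using adist_Aut[OF f x, of "inv_into D f z"] f by (simp add: Aut_maps)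
    moreover have "z = f (inv_into D f z)" using z f by (simp add: Aut_maps)
    ultimately show "z \<in> f ` closure ?B"
      using imageI[OF subsetD[OF closure_subset]] by metis
  qed
  ultimately have "closure {z \<in> D. adist (f x) z < \<rho>} \<subseteq> f ` closure ?B"
    by (intro closure_minimal compact_imp_closed)
  also have "\<dots> \<subseteq> D"
    using rc f Aut_maps unfolding relcomp_ball_def by blast
  finally show ?thesis by (simp add: relcomp_ball_def)
qed

lemma relcomp_ball_shift:
  assumes "relcomp_ball x (\<rho> + \<sigma>)" "adist x y \<le> \<sigma>" "x \<in> D" "y \<in> D"
  shows "relcomp_ball y \<rho>"
proof -
  have "{z \<in> D. adist y z < \<rho>} \<subseteq> {z \<in> D. adist x z < \<rho> + \<sigma>}"
    using assms adist_triangle[of x y] by fastforce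
  then show ?thesis
    using assms(1) closure_mono unfolding relcomp_ball_def by blast
qed

text \<open>
  The points mapped into \<open>D\<close> by the limit form a clopen set: balls of \<open>adist\<close> with closure inside \<open>D\<close>
  keep this property, with the same radius, under automorphisms.
\<close>

lemma Aut_limit_maps:
  assumes F: "\<And>k. F k \<in> Aut" and lim: "\<And>x. x \<in> D \<Longrightarrow> (\<lambda>k. F k x) \<longlonglongrightarrow> f x"
    and a: "a \<in> D" "f a \<in> D" and "x \<in> D"
  shows "f x \<in> D"
proof (rule connected_induction_simple[where P = "\<lambda>x. f x \<in> D", OF connected_D a(1) \<open>x \<in> D\<close> a(2)])
  fix p assume p: "p \<in> D"
  obtain \<rho>0 where \<rho>0: "\<rho>0 > 0" "relcomp_ball p \<rho>0"
    using relcomp_ball_exists[OF p] .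
  \<comment> \<open>Moving the centre from \<open>p\<close> to \<open>x\<close> costs
    \<open>\<rho>\<close> and leaves \<open>3 * \<rho>\<close>; of this, \<open>2 * \<rho>\<close>
    covers the distance from \<open>x\<close> to \<open>y\<close> and \<open>\<rho>\<close> that
    from \<open>F K x\<close> to \<open>F k x\<close>.\<close>
  define \<rho> where "\<rho> = \<rho>0 / 4"
  have \<rho>: "\<rho> > 0" "relcomp_ball p (3 * \<rho> + \<rho>)" using \<rho>0 by (auto simp: \<rho>_def)
  have "\<forall>\<^sub>F y in at p. adist p y < \<rho>"
    using order_tendstoD(2)[OF adist_tendsto[OF p tendsto_ident_at] \<rho>(1)] .
  then obtain e where e: "e > 0" "\<And>y. y \<noteq> p \<Longrightarrow> dist y p < e \<Longrightarrow> adist p y < \<rho>"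
    unfolding eventually_at by auto
  have "f y \<in> D" if x: "x \<in> D \<inter> ball p e" and y: "y \<in> D \<inter> ball p e" and fx: "f x \<in> D" for x y
  proof -
    have "adist p p \<le> 0" by (rule adist_le) simp
    then have "adist p p < \<rho>" using \<rho> by simp
    then have px: "adist p x < \<rho>" and py: "adist p y < \<rho>"
      using e(2)[of x] e(2)[of y] x y by (auto simp: dist_commute)
    have rx: "relcomp_ball x (3 * \<rho>)"
      using relcomp_ball_shift[OF \<rho>(2), of x] px p x by auto
    have xy: "adist x y < 2 * \<rho>"
      using adist_triangle[of x p y] px py p x y by (simp add: adist_commute)
    have "\<forall>\<^sub>F k in sequentially. adist (f x) (F k x) < \<rho> / 2"
    proof (rule order_tendstoD(2)[OF adist_tendsto[OF fx lim]])
    qed (use x \<rho> in auto)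
    then obtain K where K: "\<And>k. k \<ge> K \<Longrightarrow> adist (f x) (F k x) < \<rho> / 2"
      unfolding eventually_sequentially by blast
    have "F k y \<in> {z \<in> D. adist (F K x) z < 3 * \<rho>}" if "k \<ge> K" for k
    proof -
      have FD: "F K x \<in> D" "F k x \<in> D" "F k y \<in> D"
        using F x y Aut_maps(1) by auto
      have "adist (F K x) (F k y) \<le> adist (F K x) (F k x) + adist (F k x) (F k y)"
        by (rule adist_triangle[OF FD])
      also have "adist (F k x) (F k y) < 2 * \<rho>"
        using adist_Aut[OF F] x y xy by simp
      also have "adist (F K x) (F k x) \<le> \<rho>"
        using adist_triangle[OF FD(1) fx FD(2)] K[OF that] K[of K] by (simp add: adist_commute)
      finally show ?thesis using FD by simp
    qed
    \<comment> \<open>The centre \<open>F K x\<close> stays fixed while \<open>k\<close> grows, so a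
      single closed set inside \<open>D\<close> contains the whole tail.\<close>
    then have "f y \<in> closure {z \<in> D. adist (F K x) z < 3 * \<rho>}"
      using lim[of y] y
      by (intro Lim_in_closed_set[where F = sequentially and f = "\<lambda>k. F k y"])
         (auto simp: eventually_sequentially intro!: exI[of _ K] subsetD[OF closure_subset])
    moreover have "closure {z \<in> D. adist (F K x) z < 3 * \<rho>} \<subseteq> D"
      using relcomp_ball_Aut[OF F _ rx] x unfolding relcomp_ball_def by blast
    ultimately show ?thesis by blast
  qed
  moreover have "openin (top_of_set D) (D \<inter> ball p e)" "p \<in> D \<inter> ball p e"
    using p e(1) by (simp_all add: openin_open_Int)
  ultimately show "\<exists>T. openin (top_of_set D) T \<and> p \<in> T \<and> (\<forall>x\<in>T. \<forall>y\<in>T. f x \<in> D \<longrightarrow> f y \<in> D)"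
    by blast
qed

text \<open>The fixed points keep limits from escaping to the boundary: the limits of the maps and
  of their inverses both fix \<open>a\<close>, hence map \<open>D\<close> into itself, and passing
  to the limit in the inverse relations makes them mutually inverse. The fixed point may vary with
  \<open>k\<close>, as is needed for closedness of \<open>nondeg_pairs\<close>.\<close>

lemma Aut_sequentially_compact:
  assumes F: "\<And>k. F k \<in> Aut" and A: "\<And>k. A k \<in> D" "\<And>k. F k (A k) = A k" "A \<longlonglongrightarrow> a" "a \<in> D"
  obtains f r where "f \<in> Aut" "f a = a" "strict_mono (r :: nat \<Rightarrow> nat)"
    "\<forall>x\<in>D. (\<lambda>k. F (r k) x) \<longlonglongrightarrow> f x"
proof -
  define G where "G = (\<lambda>k. inv_into D (F k))"
  have G: "G k \<in> Aut" for k
    unfolding G_def by (rule Aut_inv[OF F])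
  have GA: "G k (A k) = A k" for k
    using Aut_maps(3)[OF F[of k] A(1)[of k]] A(2)[of k] by (simp add: G_def)
  obtain f r where r: "strict_mono (r :: nat \<Rightarrow> nat)" and f: "holomorphic_vec_on f D"
    "\<And>x. x \<in> D \<Longrightarrow> (\<lambda>k. F (r k) x) \<longlonglongrightarrow> f x"
    using Montel_vec[OF open_D, of F R] Aut_holomorphic[OF F] norm_Aut_le[OF F] by metis
  obtain g s where s: "strict_mono (s :: nat \<Rightarrow> nat)" and g: "holomorphic_vec_on g D"
    "\<And>x. x \<in> D \<Longrightarrow> (\<lambda>k. G (r (s k)) x) \<longlonglongrightarrow> g x"
    using Montel_vec[OF open_D, of "\<lambda>k. G (r k)" R] Aut_holomorphic[OF G] norm_Aut_le[OF G] by metis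
  have t: "strict_mono (\<lambda>k. r (s k))"
    using r s by (simp add: strict_mono_def)
  have f2: "(\<lambda>k. F (r (s k)) x) \<longlonglongrightarrow> f x" if "x \<in> D" for x
    using LIMSEQ_subseq_LIMSEQ[OF f(2)[OF that] s] by (simp add: o_def)
  have A2: "(\<lambda>k. A (r (s k))) \<longlonglongrightarrow> a"
    using LIMSEQ_subseq_LIMSEQ[OF A(3) t] by (simp add: o_def)
  have "(\<lambda>k. F (r (s k)) (A (r (s k)))) \<longlonglongrightarrow> f a"
    by (rule Aut_limit_compose[of "\<lambda>k. F (r (s k))" a "f a" "\<lambda>k. A (r (s k))", OF F f2[OF A(4)] A2 A(1) A(4)])
  then have fa: "f a = a" using A2 A(2) LIMSEQ_unique by auto
  have "(\<lambda>k. G (r (s k)) (A (r (s k)))) \<longlonglongrightarrow> g a"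
    by (rule Aut_limit_compose[of "\<lambda>k. G (r (s k))" a "g a" "\<lambda>k. A (r (s k))", OF G g(2)[OF A(4)] A2 A(1) A(4)])
  then have ga: "g a = a" using A2 GA LIMSEQ_unique by auto
  have fD: "f x \<in> D" if "x \<in> D" for x
    by (rule Aut_limit_maps[OF F f2 A(4)]) (use that fa A(4) in auto)
  have gD: "g x \<in> D" if "x \<in> D" for x
    by (rule Aut_limit_maps[OF G g(2) A(4)]) (use that ga A(4) in auto)
  have "f (g x) = x" if x: "x \<in> D" for x
  proof -
    have "(\<lambda>k. F (r (s k)) (G (r (s k)) x)) \<longlonglongrightarrow> f (g x)"
      by (rule Aut_limit_compose[of "\<lambda>k. F (r (s k))" "g x" "f (g x)" "\<lambda>k. G (r (s k)) x",
            OF F f2[OF gD[OF x]] g(2)[OF x] Aut_maps(1)[OF G x] gD[OF x]])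
    moreover have "F (r (s k)) (G (r (s k)) x) = x" for k
      unfolding G_def using Aut_maps(4)[OF F x] .
    ultimately show ?thesis by (simp add: LIMSEQ_const_iff)
  qed
  moreover have "g (f x) = x" if x: "x \<in> D" for x
  proof -
    have "(\<lambda>k. G (r (s k)) (F (r (s k)) x)) \<longlonglongrightarrow> g (f x)"
      by (rule Aut_limit_compose[of "\<lambda>k. G (r (s k))" "f x" "g (f x)" "\<lambda>k. F (r (s k)) x",
            OF G g(2)[OF fD[OF x]] f2[OF x] Aut_maps(1)[OF F x] fD[OF x]])
    moreover have "G (r (s k)) (F (r (s k)) x) = x" for k
      unfolding G_def using Aut_maps(3)[OF F x] .
    ultimately show ?thesis by (simp add: LIMSEQ_const_iff)
  qed
  ultimately have "f \<in> Aut"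
    using holomorphic_automorphismI[OF f(1) g(1) fD gD] by simp
  then show ?thesis
    using fa t f2 that by blast
qed

end

section \<open>Linearisation of a stabiliser\<close>

lemma fderiv_cong_open:
  assumes "open D" "x \<in> D" "f differentiable (at x)" and eq: "\<And>y. y \<in> D \<Longrightarrow> f y = g y"
  shows "fderiv g x = fderiv f x"
proof -
  have "(f has_derivative fderiv f x) (at x)"
    using assms(3) frechet_derivative_works by blast
  then have "(g has_derivative fderiv f x) (at x)"
    by (rule has_derivative_transform_within_open[OF _ assms(1,2) eq])
  then show ?thesis by (rule frechet_derivative_at[symmetric])
qed

locale pointed_bounded_domain_vec = bounded_domain_vec D R for D :: "(complex ^ 'n) set" and R +
  fixes a :: "complex ^ 'n"
  assumes a_in_D: "a \<in> D"
begin

abbreviation Stab :: "(complex ^ 'n \<Rightarrow> complex ^ 'n) set"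
  where "Stab \<equiv> {g \<in> Aut. g a = a}"

lemma Stab_inv: "g \<in> Stab \<Longrightarrow> inv_into D g \<in> Stab"
  using Aut_inv[of g] Aut_maps(3)[of g a] a_in_D by auto

lemma Stab_compose: "g \<in> Stab \<Longrightarrow> k \<in> Stab \<Longrightarrow> (\<lambda>x. g (k x)) \<in> Stab"
  using Aut_compose[of g k] by simp

lemma Stab_id: "(\<lambda>x. x) \<in> Stab"
  using Aut_id by simp

lemma Stab_maps:
  assumes "g \<in> Stab" "x \<in> D"
  shows "g x \<in> D" "inv_into D g x \<in> D" "inv_into D g (g x) = x" "g (inv_into D g x) = x"
  using Aut_maps[of g x] assms by simp_all

lemma Stab_has_derivative: "g \<in> Stab \<Longrightarrow> (g has_derivative fderiv g a) (at a)"
  using holomorphic_vec_has_derivative[OF Aut_holomorphic open_D a_in_D] by simp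

lemma Stab_clinear: "g \<in> Stab \<Longrightarrow> clinear (fderiv g a)"
  using holomorphic_vec_clinear[OF Aut_holomorphic open_D a_in_D] by simp

lemma fderiv_Stab_compose:
  assumes "g \<in> Stab" "k \<in> Stab"
  shows "fderiv (\<lambda>x. g (k x)) a v = fderiv g a (fderiv k a v)"
proof -
  have "((\<lambda>x. g (k x)) has_derivative (\<lambda>v. fderiv g a (fderiv k a v))) (at a)"
    using has_derivative_compose[OF Stab_has_derivative[OF assms(2)], of g "fderiv g a"]
      Stab_has_derivative[OF assms(1)] assms(2) by simp
  then show ?thesis
    by (metis frechet_derivative_at)
qed

text \<open>Group identities hold on \<open>D\<close> only, which is enough for derivatives at the
  interior point \<open>a\<close>.\<close>

lemma fderiv_Stab_cong:
  assumes "g \<in> Stab" "\<And>x. x \<in> D \<Longrightarrow> g x = k x"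
  shows "fderiv k a = fderiv g a"
proof (rule fderiv_cong_open[OF open_D a_in_D])
  show "g differentiable at a"
    using Stab_has_derivative[OF assms(1)] by (auto simp: differentiable_def)
qed (rule assms(2))

lemma fderiv_Stab_inverse:
  assumes g: "g \<in> Stab"
  shows "fderiv g a (fderiv (inv_into D g) a v) = v" "fderiv (inv_into D g) a (fderiv g a v) = v"
proof -
  have id: "fderiv (\<lambda>x::complex^'n. x) a v = v"
    by (simp add: frechet_derivative_at[OF has_derivative_ident, symmetric])
  have "fderiv (\<lambda>x. x) a = fderiv (\<lambda>x. g (inv_into D g x)) a"
    by (rule fderiv_Stab_cong[OF Stab_compose[OF g Stab_inv[OF g]] Stab_maps(4)[OF g]])
  then show "fderiv g a (fderiv (inv_into D g) a v) = v"
    using fderiv_Stab_compose[OF g Stab_inv[OF g]] id by metis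
  have "fderiv (\<lambda>x. x) a = fderiv (\<lambda>x. inv_into D g (g x)) a"
    by (rule fderiv_Stab_cong[OF Stab_compose[OF Stab_inv[OF g] g] Stab_maps(3)[OF g]])
  then show "fderiv (inv_into D g) a (fderiv g a v) = v"
    using fderiv_Stab_compose[OF Stab_inv[OF g] g] id by metis
qed

text \<open>All automorphisms obey the same bound \<open>R\<close> on one ball about
  \<open>a\<close>. Since the stabiliser is closed under inverses, \<open>B\<close> also bounds the
  inverse derivatives.\<close>

lemma fderiv_Stab_bounded:
  obtains B where "B > 0" "\<forall>g\<in>Stab. \<forall>v. norm (fderiv g a v) \<le> B * norm v"
proof -
  obtain r where r: "r > 0" "cball a (2 * r) \<subseteq> D"
    using open_contains_cball_twice open_D a_in_D by blast
  have "cball a r \<subseteq> cball a (2 * r)" by (rule subset_cball) (use r(1) in simp)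
  then have sub: "cball a r \<subseteq> D" using r(2) by (rule order_trans)
  define C where "C = CARD('n) * R / r"
  have "norm (fderiv g a v) \<le> (\<bar>C\<bar> + 1) * norm v" if "g \<in> Stab" for g v
  proof -
    have "norm (fderiv g a v) \<le> C * norm v"
      unfolding C_def using that r sub norm_Aut_le[of g]
      by (intro holomorphic_vec_Cauchy_estimate[OF Aut_holomorphic open_D]) auto
    also have "\<dots> \<le> (\<bar>C\<bar> + 1) * norm v"
      by (intro mult_right_mono) auto
    finally show ?thesis .
  qed
  then show ?thesis
    using that[of "\<bar>C\<bar> + 1"] by simp
qed

text \<open>A map \<open>h\<close> satisfies \<open>pull g h = h\<close> on \<open>D\<close> iff it intertwines \<open>g\<close> with its derivative at \<open>a\<close>.\<close>

definition pull :: "(complex ^ 'n \<Rightarrow> complex ^ 'n) \<Rightarrow> (complex ^ 'n \<Rightarrow> complex ^ 'n) \<Rightarrow> complex ^ 'n \<Rightarrow> complex ^ 'n"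
  where "pull g h x = fderiv (inv_into D g) a (h (g x))"

text \<open>\<open>pull\<close> is a right action of the stabiliser, up to values outside
  \<open>D\<close>.\<close>

lemma pull_pull:
  assumes g: "g \<in> Stab" and k: "k \<in> Stab" and "x \<in> D"
  shows "pull k (pull g h) x = pull (\<lambda>x. g (k x)) h x"
proof -
  let ?c = "\<lambda>x. g (k x)" and ?i = "\<lambda>x. inv_into D k (inv_into D g x)"
  have c: "?c \<in> Stab" by (rule Stab_compose[OF g k])
  have "?i y = inv_into D ?c y" if y: "y \<in> D" for y
  proof -
    have "?c (?i y) = y" "?i y \<in> D"
      using Stab_maps[OF g] Stab_maps[OF k] y by simp_all
    then show ?thesis using Stab_maps(3)[OF c, of "?i y"] by simp
  qed
  then have "fderiv (inv_into D ?c) a = fderiv ?i a"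
    by (rule fderiv_Stab_cong[OF Stab_compose[OF Stab_inv[OF k] Stab_inv[OF g]]])
  then show ?thesis
    by (simp add: pull_def fderiv_Stab_compose[OF Stab_inv[OF k] Stab_inv[OF g]])
qed

lemma pull_id: "x \<in> D \<Longrightarrow> pull (\<lambda>x. x) h x = h x"
proof -
  have "inv_into D (\<lambda>x. x) y = y" if "y \<in> D" for y
    using Stab_maps(3)[OF Stab_id that] by simp
  then have "fderiv (inv_into D (\<lambda>x. x)) a = fderiv (\<lambda>x. x) a"
    by (intro fderiv_Stab_cong[OF Stab_id]) simp
  then show ?thesis
    by (simp add: pull_def frechet_derivative_at[OF has_derivative_ident, symmetric])
qed

lemma pull_comb:
  assumes "g \<in> Stab"
  shows "pull g (\<lambda>x. c *s h1 x + d *s h2 x) x = c *s pull g h1 x + d *s pull g h2 x"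
  using Stab_clinear[OF Stab_inv[OF assms]] by (simp add: pull_def clinear_iff)

lemma pull_fderiv: "g \<in> Stab \<Longrightarrow> fderiv g a (pull g h x) = h (g x)"
  by (simp add: pull_def fderiv_Stab_inverse)

text \<open>The bound concerns the whole orbit of \<open>h\<close> rather than \<open>h\<close>
  alone: this makes the set invariant under \<open>pull\<close>, and it still supplies the uniform
  bound for Montel's theorem.\<close>

definition Lin :: "real \<Rightarrow> (complex ^ 'n \<Rightarrow> complex ^ 'n) set"
  where "Lin M = {h. holomorphic_vec_on h D \<and> h a = 0 \<and> (h has_derivative (\<lambda>v. v)) (at a) \<and>
    (\<forall>g\<in>Stab. \<forall>x\<in>D. norm (pull g h x) \<le> M)}"

lemma LinI:
  assumes "holomorphic_vec_on h D" "h a = 0" "(h has_derivative (\<lambda>v. v)) (at a)"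
    and "\<And>g x. g \<in> Stab \<Longrightarrow> x \<in> D \<Longrightarrow> norm (pull g h x) \<le> M"
  shows "h \<in> Lin M"
  using assms by (simp add: Lin_def)

lemma Lin_norm_le:
  assumes "h \<in> Lin M" "x \<in> D"
  shows "norm (h x) \<le> M"
  using assms Stab_id pull_id[of x h] unfolding Lin_def by fastforce

text \<open>The normalisation survives by the chain rule, since the outer factor of
  \<open>pull k\<close> inverts the derivative of \<open>k\<close> at \<open>a\<close>; the orbit
  bound survives because \<open>pull\<close> is an action.\<close>

lemma Lin_pull:
  assumes k: "k \<in> Stab" and h: "h \<in> Lin M"
  shows "pull k h \<in> Lin M"
proof -
  have hol: "holomorphic_vec_on h D" and h0: "h a = 0" and hd: "(h has_derivative (\<lambda>v. v)) (at a)"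
    using h by (auto simp: Lin_def)
  note lin = Stab_clinear[OF Stab_inv[OF k]]
  have ka: "k a = a" using k by simp
  have "holomorphic_vec_on (\<lambda>x. h (k x)) D"
    using k Stab_maps(1)[OF k] by (intro holomorphic_vec_on_compose[OF hol open_D Aut_holomorphic open_D]) auto
  then have "holomorphic_vec_on (pull k h) D"
    using holomorphic_vec_on_compose[OF holomorphic_vec_on_clinear[OF lin, of UNIV] open_UNIV _ open_D]
    unfolding pull_def by simp
  moreover have "pull k h a = 0"
    using ka h0 lin by (simp add: pull_def clinear_imp_linear linear_0)
  moreover have "(pull k h has_derivative (\<lambda>v. v)) (at a)"
  proof -
    have "((\<lambda>x. h (k x)) has_derivative fderiv k a) (at a)"
      using has_derivative_compose[OF Stab_has_derivative[OF k], of h "\<lambda>v. v"] hd ka by simp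
    then have "(pull k h has_derivative (\<lambda>v. fderiv (inv_into D k) a (fderiv k a v))) (at a)"
      unfolding pull_def by (rule has_derivative_compose[OF _ clinear_has_derivative[OF lin]])
    then show ?thesis by (simp add: fderiv_Stab_inverse[OF k])
  qed
  moreover have "norm (pull g (pull k h) x) \<le> M" if "g \<in> Stab" "x \<in> D" for g x
    using h Stab_compose[OF k that(1)] that unfolding pull_pull[OF k that] Lin_def by blast
  ultimately show ?thesis
    by (rule LinI)
qed

lemma Lin_midpoint:
  assumes "h1 \<in> Lin M" "h2 \<in> Lin M"
  shows "(\<lambda>x. (1/2) *s h1 x + (1/2) *s h2 x) \<in> Lin M"
proof -
  let ?m = "\<lambda>x. (1/2) *s h1 x + (1/2) *s h2 x"
  have half: "(1/2) *s v + (1/2) *s v = v" for v :: "complex ^ 'n"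
    by (simp add: vec_eq_iff)
  have "holomorphic_vec_on ?m D"
    using assms by (intro holomorphic_vec_on_comb open_D) (auto simp: Lin_def)
  moreover have "?m a = 0" using assms by (simp add: Lin_def)
  moreover have "(?m has_derivative (\<lambda>v. v)) (at a)"
  proof -
    have "(?m has_derivative (\<lambda>v. (1/2) *s v + (1/2) *s v)) (at a)"
      using assms by (intro has_derivative_add bounded_linear.has_derivative[OF bounded_linear_smult_right])
        (auto simp: Lin_def)
    then show ?thesis by (simp only: half)
  qed
  moreover have "norm (pull g ?m x) \<le> M" if "g \<in> Stab" "x \<in> D" for g x
  proof -
    have "norm (pull g h1 x) \<le> M" "norm (pull g h2 x) \<le> M"
      using assms that by (auto simp: Lin_def)
    moreover have "norm (pull g ?m x) \<le> norm (((1/2)::complex) *s pull g h1 x) + norm (((1/2)::complex) *s pull g h2 x)"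
      unfolding pull_comb[OF that(1)] by (rule norm_triangle_ineq)
    ultimately show ?thesis
      by (simp add: norm_vector_smult norm_divide)
  qed
  ultimately show ?thesis
    by (rule LinI)
qed

lemma Lin_limit:
  assumes h: "\<And>n. h n \<in> Lin M" and hol: "holomorphic_vec_on L D"
    and lim: "\<And>x. x \<in> D \<Longrightarrow> (\<lambda>n. h n x) \<longlonglongrightarrow> L x"
    and dlim: "\<And>v. (\<lambda>n. fderiv (h n) a v) \<longlonglongrightarrow> fderiv L a v"
  shows "L \<in> Lin M" and "\<And>g x. g \<in> Stab \<Longrightarrow> x \<in> D \<Longrightarrow> (\<lambda>n. pull g (h n) x) \<longlonglongrightarrow> pull g L x"
proof -
  show pl: "(\<lambda>n. pull g (h n) x) \<longlonglongrightarrow> pull g L x" if "g \<in> Stab" "x \<in> D" for g x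
    unfolding pull_def
    using has_derivative_bounded_linear[OF Stab_has_derivative[OF Stab_inv[OF that(1)]]]
    by (rule bounded_linear.tendsto) (rule lim[OF Stab_maps(1)[OF that]])
  have "fderiv (h n) a v = v" for n v
    using h[of n] frechet_derivative_at[of "h n" "\<lambda>v. v" a] unfolding Lin_def by (metis (mono_tags, lifting) mem_Collect_eq)
  then have "fderiv L a = (\<lambda>v. v)"
    using dlim by (auto simp: LIMSEQ_const_iff)
  then have "(L has_derivative (\<lambda>v. v)) (at a)"
    using holomorphic_vec_has_derivative[OF hol open_D a_in_D] by simp
  moreover have "L a = 0"
    using lim[OF a_in_D] h by (simp add: Lin_def LIMSEQ_const_iff)
  moreover have "norm (pull g L x) \<le> M" if "g \<in> Stab" "x \<in> D" for g x
    using h that by (intro LIMSEQ_le_const2[OF tendsto_norm[OF pl[OF that]]]) (auto simp: Lin_def)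
  ultimately show "L \<in> Lin M"
    by (intro LinI hol)
qed

end

text \<open>Second derivatives are avoided by translating: the difference of \<open>f\<close> and
  its translate by \<open>x - a\<close> is of size \<open>dist x a\<close>, and the Cauchy estimate
  at \<open>a\<close> bounds its derivative.\<close>

lemma holomorphic_vec_fderiv_lipschitz:
  fixes f :: "complex ^ 'n \<Rightarrow> complex ^ 'm" and M r :: real
  assumes f: "holomorphic_vec_on f D" "open D" and r: "r > 0" "cball a (4 * r) \<subseteq> D"
    and le: "\<And>x. x \<in> D \<Longrightarrow> norm (f x) \<le> M" and x: "x \<in> cball a r"
  shows "norm (fderiv f x v - fderiv f a v) \<le> CARD('m) * (CARD('m) * M / (2 * r) * dist x a) / r * norm v"
proof -
  define \<tau> where "\<tau> = (\<lambda>z. z + (x - a))"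
  define E where "E = D \<inter> \<tau> -` D"
  define u where "u = (\<lambda>z. f (\<tau> z) - f z)"
  have "open E"
    unfolding E_def \<tau>_def by (intro open_Int f open_vimage continuous_intros)
  have mem: "z \<in> cball a (2 * r)" "\<tau> z \<in> cball a (2 * r)" if "z \<in> cball a r" for z
  proof -
    have "dist a (\<tau> z) \<le> dist a z + dist a x"
      using norm_triangle_ineq[of "a - z" "a - x"] by (simp add: \<tau>_def dist_norm algebra_simps)
    then show "z \<in> cball a (2 * r)" "\<tau> z \<in> cball a (2 * r)"
      using that x r(1) by auto
  qed
  have "cball a (2 * r) \<subseteq> cball a (4 * r)" by (rule subset_cball) (use r(1) in simp)
  then have "cball a (2 * r) \<subseteq> D" using r(2) by (rule order_trans)
  then have sub: "cball a r \<subseteq> E"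
    unfolding E_def using mem by blast
  have aE: "a \<in> E" using sub r by auto
  have \<tau>: "holomorphic_vec_on \<tau> E"
    unfolding \<tau>_def by (rule holomorphic_vec_on_translate)
  have "holomorphic_vec_on (\<lambda>z. f (\<tau> z)) E"
    by (rule holomorphic_vec_on_compose[OF f \<tau> \<open>open E\<close>]) (simp add: E_def)
  then have u: "holomorphic_vec_on u E"
    unfolding u_def using f \<open>open E\<close>
    by (intro holomorphic_vec_on_diff) (auto simp: E_def intro: holomorphic_vec_on_subset)
  have "norm (fderiv u a v) \<le> CARD('m) * (CARD('m) * M / (2 * r) * dist x a) / r * norm v"
  proof (rule holomorphic_vec_Cauchy_estimate[OF u \<open>open E\<close> r(1) sub])
    fix z assume "z \<in> cball a r"
    then have "norm (f (\<tau> z) - f z) \<le> CARD('m) * M / (2 * r) * norm (\<tau> z - z)"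
      using mem[of z] r le by (intro holomorphic_vec_lipschitz[OF f, where x = a]) auto
    then show "norm (u z) \<le> CARD('m) * M / (2 * r) * dist x a"
      by (simp add: u_def \<tau>_def dist_norm)
  qed
  moreover have "fderiv u a = (\<lambda>v. fderiv f x v - fderiv f a v)"
  proof (rule frechet_derivative_at[symmetric])
    have "\<tau> a = x" by (simp add: \<tau>_def)
    have "x \<in> D" "a \<in> D" using aE \<open>\<tau> a = x\<close> by (auto simp: E_def)
    have "(\<tau> has_derivative (\<lambda>v. v + 0)) (at a)"
      unfolding \<tau>_def by (intro derivative_intros)
    then have "((\<lambda>z. f (\<tau> z)) has_derivative (\<lambda>v. fderiv f x (v + 0))) (at a)"
      by (rule has_derivative_compose) (simp add: \<open>\<tau> a = x\<close> holomorphic_vec_has_derivative[OF f \<open>x \<in> D\<close>])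
    then show "(u has_derivative (\<lambda>v. fderiv f x v - fderiv f a v)) (at a)"
      unfolding u_def using has_derivative_diff holomorphic_vec_has_derivative[OF f \<open>a \<in> D\<close>] by fastforce
  qed
  ultimately show ?thesis by simp
qed

text \<open>Near \<open>a\<close> the map \<open>f - id\<close> has derivative of norm at most
  \<open>1/2\<close>, so it is a contraction and \<open>f\<close> cannot identify two
  points.\<close>

lemma holomorphic_vec_locally_inj:
  fixes f :: "complex ^ 'n \<Rightarrow> complex ^ 'n" and M :: real
  assumes f: "holomorphic_vec_on f D" "open D" and a: "a \<in> D"
    and le: "\<And>x. x \<in> D \<Longrightarrow> norm (f x) \<le> M" and f': "(f has_derivative (\<lambda>v. v)) (at a)"
  obtains d where "d > 0" "ball a d \<subseteq> D" "inj_on f (ball a d)"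
proof -
  obtain e where e: "e > 0" "cball a e \<subseteq> D"
    using f(2) a open_contains_cball by blast
  define r where "r = e / 4"
  have r: "r > 0" "cball a (4 * r) \<subseteq> D" using e by (auto simp: r_def)
  define C where "C = CARD('n) * (CARD('n) * \<bar>M\<bar> / (2 * r)) / r"
  have "C \<ge> 0" using r by (simp add: C_def)
  define d where "d = min r (1 / (2 * (C + 1)))"
  have d: "d > 0" "d \<le> r" "C * d \<le> 1/2"
  proof -
    show "d > 0" "d \<le> r" using r \<open>C \<ge> 0\<close> by (auto simp: d_def)
    have "C * d \<le> (C + 1) * (1 / (2 * (C + 1)))"
      using \<open>C \<ge> 0\<close> \<open>d > 0\<close> by (intro mult_mono) (auto simp: d_def)
    also have "\<dots> = 1/2" using \<open>C \<ge> 0\<close> by (simp add: field_simps)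
    finally show "C * d \<le> 1/2" .
  qed
  have sub: "ball a d \<subseteq> D" using r d by (auto intro!: subsetD[OF r(2)])
  have fa: "fderiv f a = (\<lambda>v. v)" using frechet_derivative_at[OF f'] by simp
  have bound: "norm (fderiv f x v - v) \<le> 1/2 * norm v" if x: "x \<in> ball a d" for x v
  proof -
    have "norm (fderiv f x v - v) \<le> CARD('n) * (CARD('n) * \<bar>M\<bar> / (2 * r) * dist x a) / r * norm v"
      using holomorphic_vec_fderiv_lipschitz[OF f r, of "\<bar>M\<bar>" x v] le x d fa by fastforce
    also have "\<dots> = C * dist x a * norm v" by (simp add: C_def)
    also have "\<dots> \<le> C * d * norm v"
      using x \<open>C \<ge> 0\<close> by (intro mult_right_mono mult_left_mono) (auto simp: dist_commute)
    also have "\<dots> \<le> 1/2 * norm v"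
      using d by (intro mult_right_mono) auto
    finally show ?thesis .
  qed
  have "inj_on f (ball a d)"
  proof (rule inj_onI)
    fix x y assume x: "x \<in> ball a d" and y: "y \<in> ball a d" and eq: "f x = f y"
    have "norm ((f x - x) - (f y - y)) \<le> 1/2 * norm (x - y)"
    proof (rule differentiable_bound[where S = "ball a d" and f = "\<lambda>x. f x - x" and f' = "\<lambda>x v. fderiv f x v - v"])
      fix z assume z: "z \<in> ball a d"
      then have "z \<in> D" using sub by blast
      have "((\<lambda>x. f x - x) has_derivative (\<lambda>v. fderiv f z v - v)) (at z)"
        by (intro has_derivative_diff has_derivative_ident holomorphic_vec_has_derivative[OF f \<open>z \<in> D\<close>])
      then show "((\<lambda>x. f x - x) has_derivative (\<lambda>v. fderiv f z v - v)) (at z within ball a d)"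
        by (rule has_derivative_at_withinI)
      show "onorm (\<lambda>v. fderiv f z v - v) \<le> 1/2"
        using bound[OF z] by (intro onorm_bound) auto
    qed (use x y in auto)
    then have "norm (x - y) \<le> 1/2 * norm (x - y)"
      by (simp add: eq norm_minus_commute)
    then show "x = y" by simp
  qed
  then show ?thesis using d sub that by blast
qed

section \<open>The invariant functional and its minimiser\<close>

context pointed_bounded_domain_vec
begin

context
  fixes xs :: "nat \<Rightarrow> complex ^ 'n" and M :: real
  assumes xs_in_D: "\<And>j. xs j \<in> D" and xs_dense: "D \<subseteq> closure (range xs)"
begin

text \<open>A weighted square norm of the values at a dense sequence: squares give the parallelogram
  law, the weights give convergence for bounded maps, and density means that only maps vanishing on
  \<open>D\<close> have energy zero among continuous ones. Point values, unlike integrals, pass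
  directly to pointwise limits.\<close>

definition energy :: "(complex ^ 'n \<Rightarrow> complex ^ 'n) \<Rightarrow> real"
  where "energy h = (\<Sum>j. (1/2) ^ j * (norm (h (xs j)))\<^sup>2)"

definition sup_energy :: "(complex ^ 'n \<Rightarrow> complex ^ 'n) \<Rightarrow> real"
  where "sup_energy h = (SUP g\<in>Stab. energy (pull g h))"

lemma energy_bounded:
  assumes "\<And>x. x \<in> D \<Longrightarrow> norm (h x) \<le> M"
  shows "summable (\<lambda>j. (1/2) ^ j * (norm (h (xs j)))\<^sup>2)" "energy h \<le> 2 * M\<^sup>2" "0 \<le> energy h"
    "(1/2) ^ j * (norm (h (xs j)))\<^sup>2 \<le> energy h"
proof -
  have le: "(1/2) ^ j * (norm (h (xs j)))\<^sup>2 \<le> (1/2) ^ j * M\<^sup>2" for j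
    using assms[OF xs_in_D] by (intro mult_left_mono power_mono) auto
  have geo: "(\<lambda>j. (1/2) ^ j * M\<^sup>2) sums (2 * M\<^sup>2)"
    using sums_mult2[OF geometric_sums[of "1/2::real"], of "M\<^sup>2"] by simp
  show sm: "summable (\<lambda>j. (1/2) ^ j * (norm (h (xs j)))\<^sup>2)"
    using le by (intro summable_comparison_test'[OF sums_summable[OF geo], of 0]) auto
  show "energy h \<le> 2 * M\<^sup>2"
    unfolding energy_def using suminf_le[OF le sm sums_summable[OF geo]] sums_unique[OF geo] by simp
  show "0 \<le> energy h"
    unfolding energy_def using sm by (intro suminf_nonneg) auto
  show "(1/2) ^ j * (norm (h (xs j)))\<^sup>2 \<le> energy h"
    unfolding energy_def using sum_le_suminf[OF sm, of "{j}"] by simp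
qed

lemma energy_parallelogram:
  assumes u: "\<And>x. x \<in> D \<Longrightarrow> norm (u x) \<le> M" and v: "\<And>x. x \<in> D \<Longrightarrow> norm (v x) \<le> M"
  shows "energy (\<lambda>x. (1/2) *s u x + (1/2) *s v x) + energy (\<lambda>x. (1/2) *s u x + (-1/2) *s v x)
    = (energy u + energy v) / 2"
proof -
  have le: "norm ((1/2) *s u x + c *s v x) \<le> M" if "x \<in> D" "c = 1/2 \<or> c = -1/2" for x c
  proof -
    have "norm (1/2 :: complex) = 1/2" "norm (-1/2 :: complex) = 1/2" by (simp_all add: norm_divide)
    then have c: "norm c = 1/2" using that(2) by metis
    show ?thesis
      using norm_triangle_ineq[of "(1/2) *s u x" "c *s v x", unfolded norm_vector_smult c] u[OF that(1)] v[OF that(1)]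
      by (simp add: norm_divide)
  qed
  have half: "(1/2) *s z = (1/2) *\<^sub>R z" "(-1/2) *s z = (-1/2) *\<^sub>R z" for z :: "complex ^ 'n"
    using of_real_smult[of "1/2" z] of_real_smult[of "-1/2" z] by simp_all
  have id: "(norm ((1/2) *s z + (1/2) *s w))\<^sup>2 + (norm ((1/2) *s z + (-1/2) *s w))\<^sup>2
      = ((norm z)\<^sup>2 + (norm w)\<^sup>2) / 2" for z w :: "complex ^ 'n"
    unfolding half by (simp add: power2_norm_eq_inner inner_simps inner_commute field_simps)
  have "energy (\<lambda>x. (1/2) *s u x + (1/2) *s v x) + energy (\<lambda>x. (1/2) *s u x + (-1/2) *s v x)
    = (\<Sum>j. (1/2) ^ j * ((norm ((1/2) *s u (xs j) + (1/2) *s v (xs j)))\<^sup>2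
          + (norm ((1/2) *s u (xs j) + (-1/2) *s v (xs j)))\<^sup>2))"
    unfolding energy_def distrib_left by (intro suminf_add energy_bounded le) auto
  also have "\<dots> = (\<Sum>j. ((1/2) ^ j * (norm (u (xs j)))\<^sup>2 + (1/2) ^ j * (norm (v (xs j)))\<^sup>2) / 2)"
    unfolding id by (simp add: field_simps)
  also have "\<dots> = (energy u + energy v) / 2"
    unfolding energy_def using energy_bounded(1)[of u] energy_bounded(1)[of v] u v
    by (simp add: suminf_add suminf_divide summable_add)
  finally show ?thesis .
qed

lemma Lin_pull_norm_le: "h \<in> Lin M \<Longrightarrow> g \<in> Stab \<Longrightarrow> x \<in> D \<Longrightarrow> norm (pull g h x) \<le> M"
  by (simp add: Lin_def)

lemma energy_pull_le:
  assumes "h \<in> Lin M" "g \<in> Stab"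
  shows "energy (pull g h) \<le> sup_energy h"
  unfolding sup_energy_def
  using energy_bounded(2)[OF Lin_pull_norm_le[OF assms(1)]] assms(2)
  by (intro cSUP_upper bdd_aboveI2[where M = "2 * M\<^sup>2"]) auto

lemma sup_energy_le: "(\<And>g. g \<in> Stab \<Longrightarrow> energy (pull g h) \<le> c) \<Longrightarrow> sup_energy h \<le> c"
  unfolding sup_energy_def using Stab_id by (intro cSUP_least) auto

text \<open>On \<open>D\<close> the orbit of \<open>pull k h\<close> lies in the orbit of
  \<open>h\<close>. An inequality is enough to carry minimisers to minimisers.\<close>

lemma sup_energy_pull_le:
  assumes h: "h \<in> Lin M" and k: "k \<in> Stab"
  shows "sup_energy (pull k h) \<le> sup_energy h"
proof (rule sup_energy_le)
  fix g assume g: "g \<in> Stab"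
  have "energy (pull g (pull k h)) = energy (pull (\<lambda>x. k (g x)) h)"
    unfolding energy_def by (simp add: pull_pull[OF k g xs_in_D])
  also have "\<dots> \<le> sup_energy h"
    by (rule energy_pull_le[OF h Stab_compose[OF k g]])
  finally show "energy (pull g (pull k h)) \<le> sup_energy h" .
qed

lemma continuous_eq_0_on_D:
  assumes "continuous_on D u" "\<And>j. u (xs j) = (0::complex ^ 'n)" "y \<in> D"
  shows "u y = 0"
proof -
  obtain s where s: "\<And>n. s n \<in> range xs" "s \<longlonglongrightarrow> y"
    using xs_dense \<open>y \<in> D\<close> closure_sequential by blast
  have "s n \<in> D" for n using s(1)[of n] xs_in_D by auto
  then have "(\<lambda>n. u (s n)) \<longlonglongrightarrow> u y"
    by (intro continuous_on_tendsto_compose[OF assms(1) s(2) assms(3)]) simp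
  moreover have "u (s n) = 0" for n using s(1)[of n] assms(2) by auto
  ultimately show ?thesis by (simp add: LIMSEQ_const_iff)
qed

text \<open>
  By the parallelogram law some \<open>g\<^sub>n\<close> in the stabiliser make the energy of \<open>pull g\<^sub>n (h1 - h2)\<close> tend to
  zero; a limit of the \<open>g\<^sub>n\<close> then shows that \<open>h1 - h2\<close> vanishes.
\<close>

lemma minimizer_unique:
  assumes h1: "h1 \<in> Lin M" "sup_energy h1 \<le> m" and h2: "h2 \<in> Lin M" "sup_energy h2 \<le> m"
    and m: "\<And>h. h \<in> Lin M \<Longrightarrow> m \<le> sup_energy h" and y: "y \<in> D"
  shows "h1 y = h2 y"
proof -
  define mid where "mid = (\<lambda>x. (1/2) *s h1 x + (1/2) *s h2 x)"
  define u where "u = (\<lambda>x. (1/2) *s h1 x + (-1/2) *s h2 x)"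
  have mid: "mid \<in> Lin M"
    unfolding mid_def by (rule Lin_midpoint[OF h1(1) h2(1)])
  \<comment> \<open>The midpoint is again a competitor, so the energies on its orbit exceed every
    number below \<open>m\<close>.\<close>
  have "\<exists>g\<in>Stab. energy (pull g mid) > m - inverse (real (Suc n))" for n
  proof (rule ccontr)
    assume "\<not> ?thesis"
    then have "sup_energy mid \<le> m - inverse (real (Suc n))"
      by (intro sup_energy_le) (auto simp: not_less)
    moreover have "0 < inverse (real (Suc n))" by simp
    ultimately show False using m[OF mid] by linarith
  qed
  then have "\<forall>n. \<exists>g. g \<in> Stab \<and> energy (pull g mid) > m - inverse (real (Suc n))"
    unfolding Bex_def by (rule allI)
  from choice[OF this] obtain G where "\<forall>n. G n \<in> Stab \<and> energy (pull (G n) mid) > m - inverse (real (Suc n))" ..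
  then have G: "G n \<in> Stab" "energy (pull (G n) mid) > m - inverse (real (Suc n))" for n
    by simp_all
  have pu: "pull (G n) u = (\<lambda>x. (1/2) *s pull (G n) h1 x + (-1/2) *s pull (G n) h2 x)"
    and pm: "pull (G n) mid = (\<lambda>x. (1/2) *s pull (G n) h1 x + (1/2) *s pull (G n) h2 x)" for n
    unfolding u_def mid_def using pull_comb[OF G(1)] by blast+
  have nu: "norm (pull (G n) u x) \<le> M" if "x \<in> D" for n x
    using norm_triangle_ineq[of "(1/2) *s pull (G n) h1 x" "(-1/2) *s pull (G n) h2 x"]
      Lin_pull_norm_le[OF h1(1) G(1)[of n] that] Lin_pull_norm_le[OF h2(1) G(1)[of n] that]
    unfolding pu by (auto simp: norm_vector_smult norm_divide)
  have small: "energy (pull (G n) u) \<le> inverse (real (Suc n))" for n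
  proof -
    have "energy (pull (G n) mid) + energy (pull (G n) u) = (energy (pull (G n) h1) + energy (pull (G n) h2)) / 2"
      unfolding pu pm
      by (rule energy_parallelogram) (rule Lin_pull_norm_le[OF h1(1) G(1)] Lin_pull_norm_le[OF h2(1) G(1)], assumption)+
    then show ?thesis
      using energy_pull_le[OF h1(1) G(1)[of n]] energy_pull_le[OF h2(1) G(1)[of n]] h1(2) h2(2) G(2)[of n]
      by argo
  qed
  obtain B where B: "B > 0" "\<forall>g\<in>Stab. \<forall>v. norm (fderiv g a v) \<le> B * norm v"
    by (rule fderiv_Stab_bounded)
  \<comment> \<open>\<open>pull (G n) u\<close> differs from \<open>u\<close> along
    \<open>G n\<close> by an inverse derivative; the uniform bound \<open>B\<close> removes that
    factor.\<close>
  have uG: "(\<lambda>n. u (G n (xs j))) \<longlonglongrightarrow> 0" for j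
  proof (rule Lim_null_comparison)
    have "norm (u (G n (xs j))) \<le> B * sqrt (2 ^ j * inverse (real (Suc n)))" for n
    proof -
      have "(1/2) ^ j * (norm (pull (G n) u (xs j)))\<^sup>2 \<le> inverse (real (Suc n))"
        using energy_bounded(4)[of "pull (G n) u" j, OF nu] small[of n] by simp
      then have "(norm (pull (G n) u (xs j)))\<^sup>2 \<le> 2 ^ j * inverse (real (Suc n))"
        by (simp add: field_simps)
      then have "norm (pull (G n) u (xs j)) \<le> sqrt (2 ^ j * inverse (real (Suc n)))"
        by (rule real_le_rsqrt)
      moreover have "norm (u (G n (xs j))) \<le> B * norm (pull (G n) u (xs j))"
        using B(2)[rule_format, OF G(1)[of n], of "pull (G n) u (xs j)"] by (simp add: pull_fderiv[OF G(1)])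
      ultimately show ?thesis
        using B(1) by (meson less_imp_le mult_left_mono order_trans)
    qed
    then show "\<forall>\<^sub>F n in sequentially. norm (u (G n (xs j))) \<le> B * sqrt (2 ^ j * inverse (real (Suc n)))"
      by simp
    have "(\<lambda>n. B * sqrt (2 ^ j * inverse (real (Suc n)))) \<longlonglongrightarrow> B * sqrt (2 ^ j * 0)"
      by (intro tendsto_intros LIMSEQ_inverse_real_of_nat)
    then show "(\<lambda>n. B * sqrt (2 ^ j * inverse (real (Suc n)))) \<longlonglongrightarrow> 0" by simp
  qed
  have "G k \<in> Aut" and "G k a = a" for k using G(1)[of k] by simp_all
  then obtain g r where g: "g \<in> Aut" and "g a = a" and r: "strict_mono (r :: nat \<Rightarrow> nat)"
    "\<forall>x\<in>D. (\<lambda>k. G (r k) x) \<longlonglongrightarrow> g x"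
    by (rule Aut_sequentially_compact[of G "\<lambda>_. a" a, OF _ a_in_D _ tendsto_const a_in_D])
  have cont: "continuous_on D u"
    unfolding u_def using h1(1) h2(1)
    by (intro holomorphic_vec_continuous_on[OF _ open_D] holomorphic_vec_on_comb open_D) (auto simp: Lin_def)
  have "u (g (xs j)) = 0" for j
  proof -
    have "(\<lambda>k. u (G (r k) (xs j))) \<longlonglongrightarrow> u (g (xs j))"
      using Stab_maps(1)[OF G(1) xs_in_D]
      by (intro continuous_on_tendsto_compose[OF cont r(2)[rule_format, OF xs_in_D] Aut_maps(1)[OF g xs_in_D]]) auto
    moreover have "(\<lambda>k. u (G (r k) (xs j))) \<longlonglongrightarrow> 0"
      using LIMSEQ_subseq_LIMSEQ[OF uG r(1)] by (simp add: o_def)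
    ultimately show ?thesis by (rule LIMSEQ_unique)
  qed
  moreover have "continuous_on D (\<lambda>x. u (g x))"
    using continuous_on_compose2[OF cont holomorphic_vec_continuous_on[OF Aut_holomorphic[OF g] open_D]]
      Aut_maps(1)[OF g] by blast
  \<comment> \<open>\<open>g\<close> maps onto \<open>D\<close>, so \<open>u\<close> vanishes on
    \<open>D\<close> once it vanishes along \<open>g\<close>.\<close>
  ultimately have "u (g (inv_into D g y)) = 0"
    using continuous_eq_0_on_D[of "\<lambda>x. u (g x)"] Aut_maps(2)[OF g y] by blast
  then have "u y = 0" by (simp add: Aut_maps(4)[OF g y])
  then show ?thesis
    by (simp add: u_def vec_eq_iff)
qed

text \<open>The direct method: a minimising sequence has a limit in \<open>Lin M\<close> by Montel's
  theorem, and \<open>sup_energy\<close> is lower semicontinuous along it.\<close>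

lemma minimizer_exists:
  assumes ne: "Lin M \<noteq> {}"
  obtains L m where "L \<in> Lin M" "sup_energy L \<le> m" "\<forall>h\<in>Lin M. m \<le> sup_energy h"
proof -
  define m where "m = (INF h\<in>Lin M. sup_energy h)"
  have nonneg: "0 \<le> sup_energy h" if "h \<in> Lin M" for h
  proof -
    have "0 \<le> energy (pull (\<lambda>x. x) h)"
      by (rule energy_bounded(3)) (rule Lin_pull_norm_le[OF that Stab_id])
    then show ?thesis using energy_pull_le[OF that Stab_id] by simp
  qed
  have m: "m \<le> sup_energy h" if "h \<in> Lin M" for h
    unfolding m_def using nonneg that by (intro cINF_lower bdd_belowI2[where m = 0]) auto
  have "\<exists>h\<in>Lin M. sup_energy h < m + inverse (real (Suc n))" for n
  proof (rule ccontr)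
    assume "\<not> ?thesis"
    then have "m + inverse (real (Suc n)) \<le> (INF h\<in>Lin M. sup_energy h)"
      using ne by (intro cINF_greatest) (auto simp: not_less)
    moreover have "0 < inverse (real (Suc n))" by simp
    ultimately show False unfolding m_def by linarith
  qed
  then obtain H where H: "\<And>n. H n \<in> Lin M" "\<And>n. sup_energy (H n) < m + inverse (real (Suc n))"
    by metis
  obtain L k where k: "strict_mono (k :: nat \<Rightarrow> nat)" and L: "holomorphic_vec_on L D"
    "\<And>x. x \<in> D \<Longrightarrow> (\<lambda>n. H (k n) x) \<longlonglongrightarrow> L x"
    "\<And>x v. x \<in> D \<Longrightarrow> (\<lambda>n. fderiv (H (k n)) x v) \<longlonglongrightarrow> fderiv L x v"
  proof (rule Montel_vec[OF open_D, of H M])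
    show "holomorphic_vec_on (H n) D" for n using H(1)[of n] by (simp add: Lin_def)
    show "norm (H n x) \<le> M" if "x \<in> D" for n x using Lin_norm_le[OF H(1) that] .
  qed blast
  note lim = Lin_limit[of "\<lambda>n. H (k n)", OF H(1) L(1) L(2) L(3)[OF a_in_D]]
  have "sup_energy L \<le> m"
  proof (rule sup_energy_le)
    fix g assume g: "g \<in> Stab"
    have nL: "\<And>x. x \<in> D \<Longrightarrow> norm (pull g L x) \<le> M"
      by (rule Lin_pull_norm_le[OF lim(1) g])
    show "energy (pull g L) \<le> m"
      unfolding energy_def
    proof (rule suminf_le_const[OF energy_bounded(1)[of "pull g L", OF nL]])
      fix N
      \<comment> \<open>Only finite partial sums are sure to pass to the pointwise limit; bounding
        all of them bounds the series.\<close>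
      have "(\<lambda>n. \<Sum>j<N. (1/2) ^ j * (norm (pull g (H (k n)) (xs j)))\<^sup>2) \<longlonglongrightarrow>
          (\<Sum>j<N. (1/2) ^ j * (norm (pull g L (xs j)))\<^sup>2)"
        by (intro tendsto_intros lim(2) g xs_in_D)
      moreover have "(\<lambda>n. m + inverse (real (Suc (k n)))) \<longlonglongrightarrow> m + 0"
        using LIMSEQ_subseq_LIMSEQ[OF LIMSEQ_inverse_real_of_nat k]
        by (intro tendsto_add tendsto_const) (simp add: o_def)
      moreover have "(\<Sum>j<N. (1/2) ^ j * (norm (pull g (H (k n)) (xs j)))\<^sup>2) \<le> m + inverse (real (Suc (k n)))" for n
      proof -
        have nH: "\<And>x. x \<in> D \<Longrightarrow> norm (pull g (H (k n)) x) \<le> M"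
          by (rule Lin_pull_norm_le[OF H(1) g])
        have "(\<Sum>j<N. (1/2) ^ j * (norm (pull g (H (k n)) (xs j)))\<^sup>2) \<le> energy (pull g (H (k n)))"
          unfolding energy_def by (intro sum_le_suminf energy_bounded nH) auto
        then show ?thesis
          using energy_pull_le[OF H(1) g, of "k n"] H(2)[of "k n"] by simp
      qed
      ultimately show "(\<Sum>j<N. (1/2) ^ j * (norm (pull g L (xs j)))\<^sup>2) \<le> m"
        by (intro LIMSEQ_le[of _ _ "\<lambda>n. m + inverse (real (Suc (k n)))"]) auto
    qed
  qed
  then show ?thesis using lim(1) m that by blast
qed

end

text \<open>\<open>pull g\<close> carries minimisers to minimisers, so uniqueness gives
  \<open>pull g L = L\<close> on \<open>D\<close>; applying the derivative of \<open>g\<close>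
  yields the intertwining relation.\<close>

lemma linearization_exists:
  obtains L M where "holomorphic_vec_on L D" "L a = 0" "(L has_derivative (\<lambda>v. v)) (at a)"
    "\<forall>x\<in>D. norm (L x) \<le> M"
    "\<forall>g\<in>Stab. \<forall>x\<in>D. L (g x) = fderiv g a (L x)"
proof -
  obtain T where T: "countable T" "T \<subseteq> D" "D \<subseteq> closure T"
    by (rule separable[of D])
  have "T \<noteq> {}" using T(3) a_in_D by auto
  define xs where "xs = from_nat_into T"
  have xs: "range xs = T"
    unfolding xs_def by (rule range_from_nat_into[OF \<open>T \<noteq> {}\<close> T(1)])
  have D: "xs j \<in> D" for j
    using rangeI[of xs j] T(2) unfolding xs by (rule subsetD[rotated])
  have dense: "D \<subseteq> closure (range xs)"
    using T(3) unfolding xs .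
  obtain B where B: "B > 0" "\<forall>g\<in>Stab. \<forall>v. norm (fderiv g a v) \<le> B * norm v"
    by (rule fderiv_Stab_bounded)
  \<comment> \<open>Here \<open>2 * R\<close> bounds \<open>g x - a\<close> and \<open>B\<close> the
    derivative of the inverse of \<open>g\<close>, so \<open>M\<close> bounds the orbit of the
    competitor \<open>x - a\<close>.\<close>
  define M where "M = B * (2 * R)"
  have "(\<lambda>x. x + (- a)) \<in> Lin M"
  proof (rule LinI)
    show "((\<lambda>x. x + (- a)) has_derivative (\<lambda>v. v)) (at a)"
      by (auto intro!: derivative_eq_intros)
    fix g x assume g: "g \<in> Stab" and x: "x \<in> D"
    have "norm (g x + (- a)) \<le> norm (g x) + norm a"
      using norm_triangle_ineq4[of "g x" a] by simp
    also have "\<dots> \<le> 2 * R"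
      using norm_le_R[OF Stab_maps(1)[OF g x]] norm_le_R[OF a_in_D] by simp
    finally have "B * norm (g x + (- a)) \<le> M"
      unfolding M_def using B(1) by (intro mult_left_mono) auto
    then show "norm (pull g (\<lambda>x. x + (- a)) x) \<le> M"
      unfolding pull_def using B(2)[rule_format, OF Stab_inv[OF g]] order_trans by blast
  qed (simp_all add: holomorphic_vec_on_translate del: add_uminus_conv_diff)
  then have "Lin M \<noteq> {}" by blast
  then obtain L m where L: "L \<in> Lin M" "sup_energy xs L \<le> m" "\<forall>h\<in>Lin M. m \<le> sup_energy xs h"
    by (rule minimizer_exists[OF D dense])
  have "L (g x) = fderiv g a (L x)" if g: "g \<in> Stab" and x: "x \<in> D" for g x
  proof -
    have "sup_energy xs (pull g L) \<le> m"
      using sup_energy_pull_le[OF D dense L(1) g] L(2) by simp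
    then have "pull g L x = L x"
      by (rule minimizer_unique[OF D dense Lin_pull[OF g L(1)] _ L(1,2) bspec[OF L(3)] x])
    then show ?thesis
      using pull_fderiv[OF g, of L x] by simp
  qed
  then have "\<forall>g\<in>Stab. \<forall>x\<in>D. L (g x) = fderiv g a (L x)" by blast
  moreover have "\<forall>x\<in>D. norm (L x) \<le> M" using Lin_norm_le[OF L(1)] by blast
  moreover have "holomorphic_vec_on L D" "L a = 0" "(L has_derivative (\<lambda>v. v)) (at a)"
    using L(1) by (simp_all add: Lin_def)
  ultimately show ?thesis by (intro that)
qed

lemma fixed_points_accumulate:
  assumes L: "holomorphic_vec_on L D" "L a = 0" "(L has_derivative (\<lambda>v. v)) (at a)"
    and le: "\<And>x. x \<in> D \<Longrightarrow> norm (L x) \<le> M"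
    and comm: "\<And>x. x \<in> D \<Longrightarrow> L (g x) = fderiv g a (L x)"
    and g: "g \<in> Stab" and w: "fderiv g a w = w" "w \<noteq> 0" and "e > 0"
  obtains x where "x \<in> D" "x \<noteq> a" "dist a x < e" "g x = x"
proof -
  obtain d where d: "d > 0" "ball a d \<subseteq> D" "inj_on L (ball a d)"
    using holomorphic_vec_locally_inj[OF L(1) open_D a_in_D le L(3)] .
  \<comment> \<open>\<open>L (g x) = L x\<close> gives \<open>g x = x\<close> only where
    \<open>L\<close> is injective, so \<open>x\<close> must be close enough to \<open>a\<close> for
    \<open>g x\<close> to stay in \<open>ball a d\<close>.\<close>
  have "(g \<longlongrightarrow> a) (at a)"
    using has_derivative_continuous[OF Stab_has_derivative[OF g]] g by (simp add: continuous_at)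
  then have "\<forall>\<^sub>F x in at a. dist (g x) a < d" using d(1) by (rule tendstoD)
  then obtain d' where d': "d' > 0" "\<And>x. x \<noteq> a \<Longrightarrow> dist x a < d' \<Longrightarrow> dist (g x) a < d"
    unfolding eventually_at by auto
  define T where "T = ball a (min (min d d') e)"
  have T: "T \<subseteq> ball a d" "a \<in> T" using d d' \<open>e > 0\<close> by (auto simp: T_def)
  \<comment> \<open>The invertible derivative at \<open>a\<close> makes the image of
    \<open>T\<close> a neighbourhood of \<open>L a = 0\<close>, so small multiples of
    \<open>w\<close> have preimages in \<open>T\<close>.\<close>
  have "L a \<in> interior (L ` T)"
  proof (rule sussmann_open_mapping[OF open_D _ a_in_D L(3)])
    show "continuous_on D L" by (rule holomorphic_vec_continuous_on[OF L(1) open_D])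
    show "bounded_linear (\<lambda>v::complex^'n. v)" by simp
    show "a \<in> interior T" using T(2) by (simp add: T_def interior_open)
  qed (use T d in \<open>auto simp: o_def id_def\<close>)
  then obtain \<epsilon> where \<epsilon>: "\<epsilon> > 0" "ball 0 \<epsilon> \<subseteq> L ` T"
    unfolding mem_interior L(2) by blast
  define t where "t = \<epsilon> / (2 * norm w)"
  have "t > 0" using \<epsilon> w by (simp add: t_def)
  have "t *\<^sub>R w \<in> ball 0 \<epsilon>"
    using \<epsilon> w by (simp add: t_def)
  then obtain x where x: "x \<in> T" "L x = t *\<^sub>R w"
    using \<epsilon>(2) by (metis imageE subsetD)
  have "x \<noteq> a" using x L(2) \<open>t > 0\<close> w by auto
  have "x \<in> D" using x T d by blast
  have "L (g x) = L x"
    using comm[OF \<open>x \<in> D\<close>] w(1) linear_scale[OF clinear_imp_linear[OF Stab_clinear[OF g]], of t w]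
    by (simp add: x(2))
  moreover have "g x \<in> ball a d"
    using d'(2)[OF \<open>x \<noteq> a\<close>] x(1) by (simp add: T_def dist_commute)
  moreover have "x \<in> ball a d" using x T by blast
  ultimately have "g x = x" using d(3) by (auto dest: inj_onD)
  have "dist a x < e" using x(1) by (simp add: T_def)
  show ?thesis
    by (rule that[OF \<open>x \<in> D\<close> \<open>x \<noteq> a\<close> \<open>dist a x < e\<close> \<open>g x = x\<close>])
qed

end

section \<open>The exceptional pairs\<close>

text \<open>Closedness supplies the Borel measurability that the computation of the product measure
  by sections requires.\<close>

lemma negligible_if_sections_negligible:
  fixes B :: "('a::euclidean_space \<times> 'b::euclidean_space) set"
  assumes "closed B" and sec: "\<And>a. negligible {b. (a, b) \<in> B}"
  shows "negligible B"
proof -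
  have B: "B \<in> sets (lborel \<Otimes>\<^sub>M lborel)"
    using borel_closed[OF \<open>closed B\<close>] by (simp only: borel_prod sets_pair_measure_cong[OF sets_lborel sets_lborel])
  have "emeasure lborel (Pair a -` B) = 0" for a
  proof -
    have "Pair a -` B \<in> sets lborel"
      by (rule sets_Pair1[OF B])
    moreover have "Pair a -` B = {b. (a, b) \<in> B}" by auto
    ultimately show ?thesis
      using sec[of a] unfolding negligible_iff_null_sets by (simp add: null_sets_completion_iff null_sets_def)
  qed
  then have "emeasure (lborel \<Otimes>\<^sub>M lborel) B = 0"
    by (simp add: lborel.emeasure_pair_measure_alt[OF B])
  then have "B \<in> null_sets lborel"
    using borel_closed[OF \<open>closed B\<close>] by (simp add: lborel_prod null_sets_def)
  then show ?thesis
    unfolding negligible_iff_null_sets by (rule null_sets_completionI)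
qed

section \<open>Nondegeneracy of isolated fixed points\<close>

context pointed_bounded_domain_vec
begin

text \<open>A fixed vector of the derivative is a direction in which \<open>L\<close> yields fixed
  points arbitrarily near \<open>a\<close>. For holomorphic maps that are not automorphisms this
  fails: \<open>z + z^2\<close> has an isolated but degenerate fixed point at 0.\<close>

lemma finite_Fix_eigenvector:
  assumes f: "f \<in> Stab" and fin: "finite (Fix_on D f)" and w: "fderiv f a w = w"
  shows "w = 0"
proof (rule ccontr)
  assume "w \<noteq> 0"
  obtain L M where L: "holomorphic_vec_on L D" "L a = 0" "(L has_derivative (\<lambda>v. v)) (at a)"
    "\<forall>x\<in>D. norm (L x) \<le> M" "\<forall>g\<in>Stab. \<forall>x\<in>D. L (g x) = fderiv g a (L x)"
    by (rule linearization_exists)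
  obtain e where e: "e > 0" "\<forall>x\<in>Fix_on D f. x \<noteq> a \<longrightarrow> e \<le> dist a x"
    using finite_set_avoid[OF fin, of a] by blast
  obtain x where "x \<in> D" "x \<noteq> a" "dist a x < e" "f x = x"
    by (rule fixed_points_accumulate[OF L(1-3) bspec[OF L(4)] bspec[OF bspec[OF L(5) f]] f w \<open>w \<noteq> 0\<close> e(1)])
  then show False
    using e(2) by (auto simp: Fix_on_def)
qed

text \<open>Injectivity of \<open>f'(a) - id\<close> gives a lower bound \<open>B\<close>, of which
  the remainder of the derivative uses up half. One number \<open>e\<close> serves as radius and as
  constant, which leaves a single parameter for the countable covering.\<close>

lemma finite_Fix_nondegenerate:
  assumes f: "f \<in> Stab" and fin: "finite (Fix_on D f)"
  obtains e where "e > 0" "\<forall>x\<in>ball a e. e * norm (x - a) \<le> norm (f x - x)"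
proof -
  define A where "A = (\<lambda>v. fderiv f a v - v)"
  have "linear A"
    unfolding A_def using clinear_imp_linear[OF Stab_clinear[OF f]]
    by (intro linear_compose_sub linear_ident)
  moreover have "inj A"
    unfolding linear_injective_0[OF \<open>linear A\<close>]
    using finite_Fix_eigenvector[OF f fin] by (simp add: A_def)
  ultimately have "\<exists>B>0. \<forall>v. B * norm v \<le> norm (A v)"
    using linear_inj_bounded_below_pos[of A] by blast
  then obtain B where B: "B > 0" "\<And>v. B * norm v \<le> norm (A v)"
    by blast
  have "((\<lambda>x. f x - x) has_derivative A) (at a)"
    unfolding A_def by (intro has_derivative_diff has_derivative_ident Stab_has_derivative[OF f])
  then obtain d where d: "d > 0"
    "\<And>x. norm (x - a) < d \<Longrightarrow> norm (f x - x - (f a - a) - A (x - a)) \<le> B / 2 * norm (x - a)"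
    unfolding has_derivative_at_alt using B(1) by (metis half_gt_zero)
  have "f a = a" using f by simp
  define e where "e = min d (B / 2)"
  have "e * norm (x - a) \<le> norm (f x - x)" if "x \<in> ball a e" for x
  proof -
    have "norm (f x - x - A (x - a)) \<le> B / 2 * norm (x - a)"
      using d(2)[of x] that \<open>f a = a\<close> by (simp add: e_def dist_norm norm_minus_commute)
    moreover have "norm (A (x - a)) \<le> norm (f x - x) + norm (f x - x - A (x - a))"
      using norm_triangle_ineq4[of "f x - x" "f x - x - A (x - a)"] by simp
    moreover have "e * norm (x - a) \<le> B / 2 * norm (x - a)"
      by (intro mult_right_mono) (auto simp: e_def)
    ultimately show ?thesis
      using B(2)[of "x - a"] by (simp add: field_simps)
  qed
  then have "\<forall>x\<in>ball a e. e * norm (x - a) \<le> norm (f x - x)" ..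
  moreover have "e > 0" using d(1) B(1) by (simp add: e_def)
  ultimately show ?thesis by (intro that)
qed

end

section \<open>Closed sets covering the exceptional pairs\<close>

context bounded_domain_vec
begin

text \<open>The quantitative isolation of the fixed point \<open>a\<close> is chosen so as to survive pointwise limits of \<open>f\<close>.\<close>

definition nondeg_pairs :: "real \<Rightarrow> ((complex ^ 'n) \<times> (complex ^ 'n)) set"
  where "nondeg_pairs \<delta> = {(a, b). ball a \<delta> \<subseteq> D \<and> ball b \<delta> \<subseteq> D \<and>
    (\<exists>f\<in>Aut. f a = a \<and> f b = b \<and> (\<forall>x\<in>ball a \<delta>. \<delta> * norm (x - a) \<le> norm (f x - x)))}"

text \<open>Balls of a fixed radius keep limits of centres inside \<open>D\<close>, which itself is
  only open.\<close>

lemma ball_subset_limit: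
  assumes "A \<longlonglongrightarrow> a" "\<And>n. ball (A n) \<delta> \<subseteq> D"
  shows "ball a \<delta> \<subseteq> D"
proof
  fix x assume "x \<in> ball a \<delta>"
  then have "\<forall>\<^sub>F n in sequentially. dist (A n) x < \<delta>"
    by (intro order_tendstoD(2)[OF tendsto_dist[OF assms(1) tendsto_const]]) simp
  then obtain n where "dist (A n) x < \<delta>"
    unfolding eventually_sequentially by blast
  then show "x \<in> D" using assms(2)[of n] by auto
qed

text \<open>\<open>Aut_sequentially_compact\<close> is applied with the moving fixed points
  \<open>A n\<close>; the second fixed point passes to the limit by equicontinuity, and the
  inequality pointwise.\<close>

lemma closed_nondeg_pairs:
  assumes "\<delta> > 0"
  shows "closed (nondeg_pairs \<delta>)"
  unfolding closed_sequential_limits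
proof (intro allI impI, elim conjE)
  fix Z :: "nat \<Rightarrow> (complex ^ 'n) \<times> (complex ^ 'n)" and z
  assume Z: "\<forall>n. Z n \<in> nondeg_pairs \<delta>" and lim: "Z \<longlonglongrightarrow> z"
  define A where "A = (\<lambda>n. fst (Z n))"
  define B where "B = (\<lambda>n. snd (Z n))"
  obtain a b where z: "z = (a, b)" by (cases z)
  have A: "A \<longlonglongrightarrow> a" and B: "B \<longlonglongrightarrow> b"
    unfolding A_def B_def using tendsto_fst[OF lim] tendsto_snd[OF lim] by (simp_all add: z)
  have mem: "(A n, B n) \<in> nondeg_pairs \<delta>" for n
    using Z by (simp add: A_def B_def)
  have sub: "ball (A n) \<delta> \<subseteq> D" "ball (B n) \<delta> \<subseteq> D" for n
    using mem[of n] unfolding nondeg_pairs_def by simp_all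
  have AD: "A n \<in> D" and BD: "B n \<in> D" for n
    using sub[of n] centre_in_ball[of "A n" \<delta>] centre_in_ball[of "B n" \<delta>] \<open>\<delta> > 0\<close> by blast+
  have sub': "ball a \<delta> \<subseteq> D" "ball b \<delta> \<subseteq> D"
    by (rule ball_subset_limit[OF A sub(1)], rule ball_subset_limit[OF B sub(2)])
  have aD: "a \<in> D" and bD: "b \<in> D"
    using sub' centre_in_ball[of a \<delta>] centre_in_ball[of b \<delta>] \<open>\<delta> > 0\<close> by blast+
  have "\<forall>n. \<exists>f. f \<in> Aut \<and> f (A n) = A n \<and> f (B n) = B n \<and>
      (\<forall>x\<in>ball (A n) \<delta>. \<delta> * norm (x - A n) \<le> norm (f x - x))"
    using mem unfolding nondeg_pairs_def Bex_def by simp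
  from choice[OF this] obtain F where "\<forall>n. F n \<in> Aut \<and> F n (A n) = A n \<and> F n (B n) = B n \<and>
      (\<forall>x\<in>ball (A n) \<delta>. \<delta> * norm (x - A n) \<le> norm (F n x - x))" ..
  then have F: "F n \<in> Aut" "F n (A n) = A n" "F n (B n) = B n"
    "\<forall>x\<in>ball (A n) \<delta>. \<delta> * norm (x - A n) \<le> norm (F n x - x)" for n
    by simp_all
  obtain f r where f: "f \<in> Aut" "f a = a" and r: "strict_mono (r :: nat \<Rightarrow> nat)"
    and lim: "\<forall>x\<in>D. (\<lambda>k. F (r k) x) \<longlonglongrightarrow> f x"
    by (rule Aut_sequentially_compact[OF F(1) AD F(2) A aD])
  have Ar: "(\<lambda>k. A (r k)) \<longlonglongrightarrow> a" and Br: "(\<lambda>k. B (r k)) \<longlonglongrightarrow> b"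
    using LIMSEQ_subseq_LIMSEQ[OF A r] LIMSEQ_subseq_LIMSEQ[OF B r] by (simp_all add: o_def)
  have "(\<lambda>k. F (r k) (B (r k))) \<longlonglongrightarrow> f b"
    by (rule Aut_limit_compose[of "\<lambda>k. F (r k)" b "f b" "\<lambda>k. B (r k)", OF F(1) bspec[OF lim bD] Br BD bD])
  then have "(\<lambda>k. B (r k)) \<longlonglongrightarrow> f b" by (simp only: F(3))
  then have "f b = b" using Br by (rule LIMSEQ_unique)
  moreover have "\<delta> * norm (x - a) \<le> norm (f x - x)" if x: "x \<in> ball a \<delta>" for x
  proof (rule tendsto_le[OF sequentially_bot])
    have "x \<in> D" using x sub' by blast
    show "(\<lambda>k. norm (F (r k) x - x)) \<longlonglongrightarrow> norm (f x - x)"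
      by (intro tendsto_intros bspec[OF lim \<open>x \<in> D\<close>])
    show "(\<lambda>k. \<delta> * norm (x - A (r k))) \<longlonglongrightarrow> \<delta> * norm (x - a)"
      by (intro tendsto_intros Ar)
    \<comment> \<open>The inequality is known on moving balls; as the ball about \<open>a\<close> is
      open, \<open>x\<close> eventually lies in them.\<close>
    have "\<forall>\<^sub>F k in sequentially. dist (A (r k)) x < \<delta>"
      using x by (intro order_tendstoD(2)[OF tendsto_dist[OF Ar tendsto_const]]) simp
    then show "\<forall>\<^sub>F k in sequentially. \<delta> * norm (x - A (r k)) \<le> norm (F (r k) x - x)"
      by eventually_elim (use F(4) in simp)
  qed
  ultimately show "z \<in> nondeg_pairs \<delta>"
    unfolding nondeg_pairs_def z using f sub' by blast
qed

text \<open>\<open>L\<close> serves the whole stabiliser of \<open>a\<close> at once, so all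
  admissible \<open>b\<close> lie in one null set, however many automorphisms are involved.\<close>

lemma negligible_nondeg_section:
  assumes "\<delta> > 0"
  shows "negligible {b. (a, b) \<in> nondeg_pairs \<delta>}"
proof (cases "a \<in> D")
  case False
  then have "\<not> ball a \<delta> \<subseteq> D"
    using centre_in_ball[of a \<delta>] \<open>\<delta> > 0\<close> by blast
  then have "{b. (a, b) \<in> nondeg_pairs \<delta>} = {}"
    by (simp add: nondeg_pairs_def)
  then show ?thesis by simp
next
  case True
  then interpret pointed_bounded_domain_vec D R a
    by unfold_locales
  obtain L M where L: "holomorphic_vec_on L D" "L a = 0" "(L has_derivative (\<lambda>v. v)) (at a)"
    "\<forall>x\<in>D. norm (L x) \<le> M" "\<forall>g\<in>Stab. \<forall>x\<in>D. L (g x) = fderiv g a (L x)"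
    by (rule linearization_exists)
  obtain d where d: "d > 0" "ball a d \<subseteq> D" "inj_on L (ball a d)"
    by (rule holomorphic_vec_locally_inj[OF L(1) open_D True bspec[OF L(4)] L(3)])
  \<comment> \<open>Injectivity near \<open>a\<close> yields a point \<open>q\<close> with
    \<open>L q\<close> nonzero, so that \<open>negligible_zeros\<close> applies.\<close>
  have "ball a d \<noteq> {a}"
    using not_open_singleton[of a] open_ball[of a d] by metis
  then obtain q where q: "q \<in> ball a d" "q \<noteq> a"
    using d(1) by (metis centre_in_ball empty_iff insertI1 subsetI subset_antisym singletonD singletonI subset_singletonD)
  have "L q \<noteq> 0"
    using inj_onD[OF d(3), of q a] q d(1) L(2) by auto
  then have neg: "negligible {x \<in> D. L x = 0}"
    using q(1) d(2) by (intro negligible_zeros[OF L(1) open_D connected_D, of q]) auto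
  have "{b. (a, b) \<in> nondeg_pairs \<delta>} \<subseteq> {x \<in> D. L x = 0}"
  proof
    fix b assume "b \<in> {b. (a, b) \<in> nondeg_pairs \<delta>}"
    then have "ball b \<delta> \<subseteq> D" and "\<exists>f. f \<in> Aut \<and> f a = a \<and> f b = b \<and>
        (\<forall>x\<in>ball a \<delta>. \<delta> * norm (x - a) \<le> norm (f x - x))"
      by (auto simp: nondeg_pairs_def)
    then obtain f where f: "f \<in> Stab" "f b = b" "\<forall>x\<in>ball a \<delta>. \<delta> * norm (x - a) \<le> norm (f x - x)"
      by auto
    have b: "b \<in> D" using \<open>ball b \<delta> \<subseteq> D\<close> centre_in_ball[of b \<delta>] \<open>\<delta> > 0\<close> by blast
    have eig: "fderiv f a (L b) = L b"
      using bspec[OF bspec[OF L(5) f(1)] b] f(2) by simp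
    have "L b = 0"
    proof (rule ccontr)
      assume "L b \<noteq> 0"
      obtain x where x: "x \<in> D" "x \<noteq> a" "dist a x < \<delta>" "f x = x"
        by (rule fixed_points_accumulate[OF L(1-3) bspec[OF L(4)] bspec[OF bspec[OF L(5) f(1)]] f(1)
              eig \<open>L b \<noteq> 0\<close> \<open>\<delta> > 0\<close>])
      have "\<delta> * norm (x - a) \<le> 0" using bspec[OF f(3), of x] x(3,4) by simp
      then show False using \<open>\<delta> > 0\<close> \<open>x \<noteq> a\<close> by (simp add: mult_le_0_iff)
    qed
    then show "b \<in> {x \<in> D. L x = 0}" using b by simp
  qed
  then show ?thesis using neg negligible_subset by blast
qed

text \<open>All conditions in \<open>nondeg_pairs\<close> weaken as \<open>\<delta>\<close>
  decreases, so the countably many values \<open>1 / (m + 1)\<close> suffice.\<close>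

lemma finite_Fix_nondeg_pairs:
  assumes "a \<in> D" "b \<in> D" "f \<in> Aut" "f a = a" "f b = b" "finite (Fix_on D f)"
  shows "\<exists>m. (a, b) \<in> nondeg_pairs (inverse (real (Suc m)))"
proof -
  interpret pointed_bounded_domain_vec D R a
    using assms(1) by unfold_locales
  have "f \<in> Stab" using assms by simp
  then obtain e where e: "e > 0" "\<forall>x\<in>ball a e. e * norm (x - a) \<le> norm (f x - x)"
    using assms(6) by (rule finite_Fix_nondegenerate)
  obtain r where r: "r > 0" "ball a r \<subseteq> D"
    using open_D \<open>a \<in> D\<close> open_contains_ball by metis
  obtain s where s: "s > 0" "ball b s \<subseteq> D"
    using open_D \<open>b \<in> D\<close> open_contains_ball by metis
  obtain m where m: "inverse (real (Suc m)) < min e (min r s)"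
    using reals_Archimedean[of "min e (min r s)"] e r s by auto
  define \<delta> where "\<delta> = inverse (real (Suc m))"
  have \<delta>: "\<delta> < e" "\<delta> < r" "\<delta> < s" using m by (simp_all add: \<delta>_def)
  have "ball a \<delta> \<subseteq> D" "ball b \<delta> \<subseteq> D"
    using subset_ball[of \<delta> r a] subset_ball[of \<delta> s b] r(2) s(2) \<delta> by auto
  moreover have "\<delta> * norm (x - a) \<le> norm (f x - x)" if "x \<in> ball a \<delta>" for x
  proof -
    have "\<delta> * norm (x - a) \<le> e * norm (x - a)"
      using \<delta>(1) by (intro mult_right_mono) auto
    moreover have "x \<in> ball a e" using that \<delta>(1) by simp
    ultimately show ?thesis using e(2) order_trans by blast
  qed
  ultimately have "(a, b) \<in> nondeg_pairs \<delta>"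
    unfolding nondeg_pairs_def using assms by blast
  then show ?thesis unfolding \<delta>_def by blast
qed

end

theorem theorem3p1:
  fixes D :: "(complex ^ 'n) set" and N :: "((complex ^ 'n) \<times> (complex ^ 'n)) set"
  assumes "domain_vec D" and "bounded D"
    and "N = {(a, b). a \<in> D \<and> b \<in> D \<and>
               \<not> (\<exists>f. holomorphic_automorphism D f \<and> Fix_on D f = {a, b})}"
  shows "\<exists>M. M \<subseteq> N \<and> D \<times> D - M \<in> null_sets lebesgue"
proof -
  obtain R where "\<forall>x\<in>D. norm x \<le> R"
    using assms(2) unfolding bounded_iff by blast
  then interpret bounded_domain_vec D R
    using assms(1) by unfold_locales (auto simp: domain_vec_def)
  \<comment> \<open>What enters is that \<open>a\<close> and \<open>b\<close> are fixed and that the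
    fixed point set is finite; pairs with \<open>a = b\<close> are covered too.\<close>
  have "D \<times> D - N \<subseteq> (\<Union>m. nondeg_pairs (inverse (real (Suc m))))"
  proof
    fix z assume "z \<in> D \<times> D - N"
    then obtain a b f where z: "z = (a, b)" "a \<in> D" "b \<in> D"
      and f: "holomorphic_automorphism D f" "Fix_on D f = {a, b}"
      by (auto simp: assms(3))
    have "a \<in> Fix_on D f" "b \<in> Fix_on D f" "finite (Fix_on D f)"
      by (simp_all add: f(2))
    then have "\<exists>m. (a, b) \<in> nondeg_pairs (inverse (real (Suc m)))"
      using z f(1) by (intro finite_Fix_nondeg_pairs[of a b f]) (auto simp: Fix_on_def)
    then show "z \<in> (\<Union>m. nondeg_pairs (inverse (real (Suc m))))"
      by (simp add: z(1))
  qed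
  moreover have "negligible (\<Union>m. nondeg_pairs (inverse (real (Suc m))))"
    by (intro negligible_Union_nat negligible_if_sections_negligible closed_nondeg_pairs negligible_nondeg_section) simp_all
  ultimately have "negligible (D \<times> D - N)"
    using negligible_subset by blast
  \<comment> \<open>The witness is \<open>N\<close> itself.\<close>
  then show ?thesis
    unfolding negligible_iff_null_sets by blast
qed

end
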